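(* Let $\zeta\in\mathbb{C}$ with $\zeta^3=1$, $\zeta\ne1$, and consider the polynomial system on $\mathbb{C}^3$ $$\dot x_1 = x_1+\sum_{(p,q,r)\in S}a_{pqr}x_1^{p+1}x_2^{q}x_3^{r},\qquad \dot x_2=\zeta\Big(x_2+\sum_{(p,q,r)\in S}b_{rpq}x_1^{r}x_2^{p+1}x_3^{q}\Big),\qquad \dot x_3=\zeta^2\Big(x_3+\sum_{(p,q,r)\in S}c_{qrp}x_1^{q}x_2^{r}x_3^{p+1}\Big),$$ where $S\subset\mathbb{N}_{-1}\times\mathbb{N}_0\times\mathbb{N}_0$ is a finite set of triples with $p+q+r\ge1$ for every $(p,q,r)\in S$, and the coefficients $a_{pqr},b_{rpq},c_{qrp}$ are complex numbers. Let $$\dot y_1=y_1+y_1Y_1(y_1y_2y_3),\qquad \dot y_2=\zeta y_2+y_2Y_2(y_1y_2y_3),\qquad \dot y_3=\zeta^2y_3+y_3Y_3(y_1y_2y_3)$$ be its distinguished normal form, where $Y_1,Y_2,Y_3$ are formal power series in one variable without constant term. Then: 1) If the system in $x$ has a formal first integral of the form $\Phi(x)=x_1x_2x_3+\text{(terms of degree}\ge4)$, then $Y_1+Y_2+Y_3\equiv0$ and the distinguished normal form is convergent. 2) If $Y_1+Y_2+Y_3\equiv0$, then the system in $x$ has a convergent first integral of the form $\Phi(x)=x_1x_2x_3+\text{(terms of degree}\ge4)$.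
   Context: $\mathbb{N}_0=\{0,1,2,\dots\}$ and $\mathbb{N}_{-1}=\mathbb{N}_0\cup\{-1\}$. Consider a system $\dot x=Ax+X(x)$, $x\in\mathbb{C}^n$, with $A=\mathrm{diag}(\lambda_1,\dots,\lambda_n)$ and $X$ starting with terms of degree at least two. A monomial $x^\alpha=x_1^{\alpha_1}\cdots x_n^{\alpha_n}$, $\alpha\in\mathbb{N}_0^n$, $|\alpha|=\alpha_1+\cdots+\alpha_n\ge2$, in the $k$-th component of a vector of power series is called resonant if $\alpha_1\lambda_1+\cdots+\alpha_n\lambda_n-\lambda_k=0$, and non-resonant otherwise. A formal change of coordinates $x=y+h(y)$, with $h$ a vector of formal power series starting with terms of degree at least two, is a normalizing transformation if the transformed system $\dot y=Ay+G(y)$ is such that $G$ contains only resonant terms; the transformed system is then a (Poincaré–Dulac) normal form. The normalizing transformation for which $h$ contains only non-resonant terms is unique; it is called the distinguished normalizing transformation, and the corresponding normal form is the distinguished normal form. For the system in the claim $(\lambda_1,\lambda_2,\lambda_3)=(1,\zeta,\zeta^2)$, and every normal form has the displayed shape, with $Y_1(w)=\sum_{k\ge1}Y_1^{(k+1,k,k)}w^k$, $Y_2(w)=\sum_{k\ge1}Y_2^{(k,k+1,k)}w^k$, $Y_3(w)=\sum_{k\ge1}Y_3^{(k,k,k+1)}w^k$. A formal (respectively convergent) first integral of a system $\dot x_i=F_i(x)$ is a formal (respectively convergent in a neighbourhood of the origin) power series $\Phi$ with $\sum_iF_i\,\partial\Phi/\partial x_i\equiv0$. "Convergent" means that the power series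 involved converge in a neighbourhood of the origin. *)

theory Defs
  imports "HOL-Analysis.Analysis"
begin

section \<open>Formal power series in finitely many variables\<close>

text \<open>
  The variables are indexed by a finite type; a multi-index is a vector of natural numbers,
  and a series is given by its coefficients.
\<close>

typedef (overloaded) ('a, 'n) mfps = "UNIV :: (nat ^ 'n \<Rightarrow> 'a) set"
  morphisms mfps_nth Abs_mfps by simp

lemma mfps_nth_Abs [simp]: "mfps_nth (Abs_mfps f) \<alpha> = f \<alpha>"
  by (simp add: Abs_mfps_inverse)

lemma mfps_eqI: "(\<And>\<alpha>. mfps_nth f \<alpha> = mfps_nth g \<alpha>) \<Longrightarrow> f = g"
  by (metis ext mfps_nth_inject)

lemma mfps_eq_iff: "f = g \<longleftrightarrow> (\<forall>\<alpha>. mfps_nth f \<alpha> = mfps_nth g \<alpha>)"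
  by (auto intro: mfps_eqI)

lemma finite_vec_set:
  fixes A :: "'n::finite \<Rightarrow> 'b set"
  assumes "\<And>i. finite (A i)"
  shows "finite {v :: 'b ^ 'n. \<forall>i. v $ i \<in> A i}"
proof -
  have "finite (PiE UNIV A)"
    using assms by (intro finite_PiE) auto
  moreover have "{v :: 'b ^ 'n. \<forall>i. v $ i \<in> A i} \<subseteq> vec_lambda ` PiE UNIV A"
  proof
    fix v :: "'b ^ 'n" assume "v \<in> {v. \<forall>i. v $ i \<in> A i}"
    then have "v = vec_lambda (($) v)" "($) v \<in> PiE UNIV A" by auto
    then show "v \<in> vec_lambda ` PiE UNIV A" by (rule image_eqI)
  qed
  ultimately show ?thesis by (meson finite_imageI finite_subset)
qed

lemma finite_splits [simp]:
  fixes \<gamma> :: "nat ^ 'n"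
  shows "finite {(\<alpha>, \<beta>). \<alpha> + \<beta> = \<gamma>}"
proof -
  let ?B = "{v :: nat ^ 'n. \<forall>i. v $ i \<in> {..\<gamma> $ i}}"
  have "finite ?B" by (rule finite_vec_set) simp
  moreover have "{(\<alpha>, \<beta>). \<alpha> + \<beta> = \<gamma>} \<subseteq> ?B \<times> ?B"
    by (auto simp: vec_eq_iff) (metis le_add1, metis le_add2)
  ultimately show ?thesis by (meson finite_SigmaI finite_subset)
qed

subsection \<open>Ring structure\<close>

instantiation mfps :: (zero, finite) zero
begin
definition zero_mfps_def: "0 = Abs_mfps (\<lambda>_. 0)"
instance ..
end

instantiation mfps :: ("{one, zero}", finite) one
begin
definition one_mfps_def: "1 = Abs_mfps (\<lambda>\<alpha>. if \<alpha> = 0 then 1 else 0)"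
instance ..
end

instantiation mfps :: (plus, finite) plus
begin
definition plus_mfps_def: "f + g = Abs_mfps (\<lambda>\<alpha>. mfps_nth f \<alpha> + mfps_nth g \<alpha>)"
instance ..
end

instantiation mfps :: (minus, finite) minus
begin
definition minus_mfps_def: "f - g = Abs_mfps (\<lambda>\<alpha>. mfps_nth f \<alpha> - mfps_nth g \<alpha>)"
instance ..
end

instantiation mfps :: (uminus, finite) uminus
begin
definition uminus_mfps_def: "- f = Abs_mfps (\<lambda>\<alpha>. - mfps_nth f \<alpha>)"
instance ..
end

instantiation mfps :: ("{comm_monoid_add, times}", finite) times
begin
definition times_mfps_def:
  "f * g = Abs_mfps (\<lambda>\<gamma>. \<Sum>(\<alpha>, \<beta>) | \<alpha> + \<beta> = \<gamma>. mfps_nth f \<alpha> * mfps_nth g \<beta>)"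
instance ..
end

lemma mfps_nth_zero [simp]: "mfps_nth 0 \<alpha> = 0"
  by (simp add: zero_mfps_def)

lemma mfps_nth_one: "mfps_nth 1 \<alpha> = (if \<alpha> = 0 then 1 else 0)"
  by (simp add: one_mfps_def)

lemma mfps_nth_add [simp]: "mfps_nth (f + g) \<alpha> = mfps_nth f \<alpha> + mfps_nth g \<alpha>"
  by (simp add: plus_mfps_def)

lemma mfps_nth_diff [simp]: "mfps_nth (f - g) \<alpha> = mfps_nth f \<alpha> - mfps_nth g \<alpha>"
  by (simp add: minus_mfps_def)

lemma mfps_nth_uminus [simp]: "mfps_nth (- f) \<alpha> = - mfps_nth f \<alpha>"
  by (simp add: uminus_mfps_def)

lemma mfps_nth_mult:
  "mfps_nth (f * g) \<gamma> = (\<Sum>(\<alpha>, \<beta>) | \<alpha> + \<beta> = \<gamma>. mfps_nth f \<alpha> * mfps_nth g \<beta>)"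
  by (simp add: times_mfps_def)

instance mfps :: (comm_ring_1, finite) comm_ring_1
proof
  fix f g h :: "('a, 'b) mfps"
  show "f + g + h = f + (g + h)" by (rule mfps_eqI) (simp add: add.assoc)
  show "f + g = g + f" by (rule mfps_eqI) (simp add: add.commute)
  show "0 + f = f" by (rule mfps_eqI) simp
  show "- f + f = 0" by (rule mfps_eqI) simp
  show "f - g = f + - g" by (rule mfps_eqI) simp
  show "(0 :: ('a, 'b) mfps) \<noteq> 1"
    by (auto simp: mfps_eq_iff mfps_nth_one)
  show "f * g = g * f"
    unfolding mfps_eq_iff mfps_nth_mult
    by (intro allI sum.reindex_bij_witness[of _ prod.swap prod.swap])
       (auto simp: add.commute mult.commute)
  show "(f + g) * h = f * h + g * h"
    by (rule mfps_eqI)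
       (simp add: mfps_nth_mult distrib_right sum.distrib case_prod_unfold)
  show "1 * f = f"
  proof (rule mfps_eqI)
    fix \<gamma> :: "nat ^ 'b"
    have "mfps_nth (1 * f) \<gamma> =
        (\<Sum>x\<in>{(\<alpha>, \<beta>). \<alpha> + \<beta> = \<gamma>}. if x = (0, \<gamma>) then mfps_nth f \<gamma> else 0)"
      unfolding mfps_nth_mult by (rule sum.cong) (auto simp: mfps_nth_one split: if_splits)
    also have "\<dots> = mfps_nth f \<gamma>"
      by (subst sum.delta) auto
    finally show "mfps_nth (1 * f) \<gamma> = mfps_nth f \<gamma>" .
  qed
  show "f * g * h = f * (g * h)"
  proof (rule mfps_eqI)
    fix \<gamma> :: "nat ^ 'b"
    let ?t = "\<lambda>\<alpha> \<beta> \<delta>. mfps_nth f \<alpha> * mfps_nth g \<beta> * mfps_nth h \<delta>"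
    have "mfps_nth (f * g * h) \<gamma> =
        (\<Sum>x | fst x + snd x = \<gamma>. \<Sum>y | fst y + snd y = fst x. ?t (fst y) (snd y) (snd x))"
      by (simp add: mfps_nth_mult sum_distrib_right case_prod_unfold)
    also have "\<dots> = (\<Sum>(x, y) \<in> Sigma {x. fst x + snd x = \<gamma>} (\<lambda>x. {y. fst y + snd y = fst x}).
        ?t (fst y) (snd y) (snd x))"
      using finite_splits[where 'n = 'b]
      by (intro sum.Sigma) (auto simp: case_prod_unfold)
    also have "\<dots> = (\<Sum>(x, y) \<in> Sigma {x. fst x + snd x = \<gamma>} (\<lambda>x. {y. fst y + snd y = snd x}).
        ?t (fst x) (fst y) (snd y))"
      by (rule sum.reindex_bij_witness
            [of _ "\<lambda>(x, y). ((fst x + fst y, snd y), (fst x, fst y))"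
                  "\<lambda>(x, y). ((fst y, snd y + snd x), (snd y, snd x))"])
         (auto simp: add.assoc)
    also have "\<dots> = (\<Sum>x | fst x + snd x = \<gamma>. \<Sum>y | fst y + snd y = snd x.
        ?t (fst x) (fst y) (snd y))"
      using finite_splits[where 'n = 'b]
      by (intro sum.Sigma[symmetric]) (auto simp: case_prod_unfold)
    also have "\<dots> = mfps_nth (f * (g * h)) \<gamma>"
      by (simp add: mfps_nth_mult sum_distrib_left case_prod_unfold mult.assoc)
    finally show "mfps_nth (f * g * h) \<gamma> = mfps_nth (f * (g * h)) \<gamma>" .
  qed
qed

subsection \<open>Degree, constants, variables, derivatives, composition, convergence\<close>

definition mdeg :: "nat ^ 'n::finite \<Rightarrow> nat" where
  "mdeg \<alpha> = (\<Sum>i\<in>UNIV. \<alpha> $ i)"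

definition starts_at :: "nat \<Rightarrow> ('a::zero, 'n::finite) mfps \<Rightarrow> bool" where
  "starts_at d f \<longleftrightarrow> (\<forall>\<alpha>. mdeg \<alpha> < d \<longrightarrow> mfps_nth f \<alpha> = 0)"

definition mfps_const :: "'a::zero \<Rightarrow> ('a, 'n::finite) mfps" where
  "mfps_const c = Abs_mfps (\<lambda>\<alpha>. if \<alpha> = 0 then c else 0)"

definition mfps_X :: "'n \<Rightarrow> ('a::{zero, one}, 'n::finite) mfps" where
  "mfps_X i = Abs_mfps (\<lambda>\<alpha>. if \<alpha> = axis i 1 then 1 else 0)"

definition mfps_deriv :: "'n \<Rightarrow> ('a::comm_ring_1, 'n::finite) mfps \<Rightarrow> ('a, 'n) mfps" where
  "mfps_deriv i f = Abs_mfps (\<lambda>\<alpha>. of_nat (\<alpha> $ i + 1) * mfps_nth f (\<alpha> + axis i 1))"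

text \<open>
  Substitution of a vector \<open>g\<close> of series without constant term into \<open>f\<close>. The sum may be cut off
  at the degree of \<open>\<gamma>\<close>, see \<open>starts_at_monomial\<close> below. The second operation is the
  substitution of a single such series into a series in one variable.
\<close>

definition mfps_compose ::
    "('a::comm_ring_1, 'm::finite) mfps \<Rightarrow> ('a, 'n::finite) mfps ^ 'm \<Rightarrow> ('a, 'n) mfps" where
  "mfps_compose f g = Abs_mfps (\<lambda>\<gamma>.
     \<Sum>\<alpha> | mdeg \<alpha> \<le> mdeg \<gamma>. mfps_nth f \<alpha> * mfps_nth (\<Prod>i\<in>UNIV. (g $ i) ^ (\<alpha> $ i)) \<gamma>)"

definition fps_subst :: "'a::comm_ring_1 fps \<Rightarrow> ('a, 'n::finite) mfps \<Rightarrow> ('a, 'n) mfps" where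
  "fps_subst f u = Abs_mfps (\<lambda>\<gamma>. \<Sum>k\<le>mdeg \<gamma>. fps_nth f k * mfps_nth (u ^ k) \<gamma>)"

text \<open>Convergence (automatically absolute) on a neighbourhood of the origin.\<close>

definition mfps_convergent :: "(complex, 'n::finite) mfps \<Rightarrow> bool" where
  "mfps_convergent f \<longleftrightarrow>
     (\<exists>r>0. \<forall>x :: complex ^ 'n. norm x < r \<longrightarrow>
        (\<lambda>\<alpha>. mfps_nth f \<alpha> * (\<Prod>i\<in>UNIV. (x $ i) ^ (\<alpha> $ i))) summable_on UNIV)"

lemma mdeg_add: "mdeg (\<alpha> + \<beta>) = mdeg \<alpha> + mdeg \<beta>"
  by (simp add: mdeg_def sum.distrib)

lemma mdeg_zero_iff [simp]: "mdeg \<alpha> = 0 \<longleftrightarrow> \<alpha> = 0"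
  by (auto simp: mdeg_def vec_eq_iff)

lemma finite_mdeg_le [simp]: "finite {\<alpha> :: nat ^ 'n::finite. mdeg \<alpha> \<le> d}"
proof (rule finite_subset)
  show "finite {\<alpha> :: nat ^ 'n. \<forall>i. \<alpha> $ i \<in> {..d}}"
    by (rule finite_vec_set) simp
  have "\<alpha> $ i \<le> mdeg \<alpha>" for \<alpha> :: "nat ^ 'n" and i
    unfolding mdeg_def by (rule member_le_sum) auto
  then show "{\<alpha> :: nat ^ 'n. mdeg \<alpha> \<le> d} \<subseteq> {\<alpha>. \<forall>i. \<alpha> $ i \<in> {..d}}"
    using order_trans by fastforce
qed

lemma starts_at_0 [simp]: "starts_at 0 f"
  by (simp add: starts_at_def)

lemma starts_at_mult:
  fixes f g :: "('a::comm_ring_1, 'n::finite) mfps"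
  assumes "starts_at d f" "starts_at e g"
  shows "starts_at (d + e) (f * g)"
  unfolding starts_at_def mfps_nth_mult
proof (intro allI impI sum.neutral ballI)
  fix \<gamma> :: "nat ^ 'n" and p
  assume lt: "mdeg \<gamma> < d + e" and "p \<in> {(\<alpha>, \<beta>). \<alpha> + \<beta> = \<gamma>}"
  then obtain \<alpha> \<beta> where p: "p = (\<alpha>, \<beta>)" "\<alpha> + \<beta> = \<gamma>" by auto
  then have "mdeg \<alpha> < d \<or> mdeg \<beta> < e" using lt mdeg_add[of \<alpha> \<beta>] by auto
  then show "(case p of (\<alpha>, \<beta>) \<Rightarrow> mfps_nth f \<alpha> * mfps_nth g \<beta>) = 0"
    using assms p by (auto simp: starts_at_def)
qed

lemma starts_at_power: "starts_at 1 f \<Longrightarrow> starts_at k (f ^ k)"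
  for f :: "('a::comm_ring_1, 'n::finite) mfps"
proof (induction k)
  case (Suc k)
  then show ?case using starts_at_mult[of 1 f k "f ^ k"] by simp
qed simp

lemma starts_at_monomial:
  fixes g :: "('a::comm_ring_1, 'n::finite) mfps ^ 'm::finite"
  assumes "\<And>i. starts_at 1 (g $ i)"
  shows "starts_at (mdeg \<alpha>) (\<Prod>i\<in>UNIV. (g $ i) ^ (\<alpha> $ i))"
proof -
  have "starts_at (\<Sum>i\<in>I. \<alpha> $ i) (\<Prod>i\<in>I. (g $ i) ^ (\<alpha> $ i))" if "finite I" for I
    using that by induction (auto intro!: starts_at_mult starts_at_power assms)
  then show ?thesis by (simp add: mdeg_def)
qed

section \<open>Normal forms of formal vector fields\<close>

definition linear_field :: "complex ^ 'n \<Rightarrow> (complex, 'n::finite) mfps ^ 'n" where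
  "linear_field lam = (\<chi> k. mfps_const (lam $ k) * mfps_X k)"

definition resonant :: "complex ^ 'n \<Rightarrow> 'n::finite \<Rightarrow> nat ^ 'n \<Rightarrow> bool" where
  "resonant lam k \<alpha> \<longleftrightarrow> mdeg \<alpha> \<ge> 2 \<and> (\<Sum>i\<in>UNIV. of_nat (\<alpha> $ i) * lam $ i) - lam $ k = 0"

definition nonresonant :: "complex ^ 'n \<Rightarrow> 'n::finite \<Rightarrow> nat ^ 'n \<Rightarrow> bool" where
  "nonresonant lam k \<alpha> \<longleftrightarrow> mdeg \<alpha> \<ge> 2 \<and> (\<Sum>i\<in>UNIV. of_nat (\<alpha> $ i) * lam $ i) - lam $ k \<noteq> 0"

text \<open>
  The substitution \<open>x = y + h(y)\<close> takes the system with right-hand side \<open>F\<close> to the one with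
  right-hand side \<open>N\<close>: differentiating along solutions, \<open>(I + Dh(y)) N(y) = F(y + h(y))\<close>. Since
  \<open>I + Dh\<close> is formally invertible, this determines \<open>N\<close>.
\<close>

definition transforms_to ::
    "(complex, 'n::finite) mfps ^ 'n \<Rightarrow> (complex, 'n) mfps ^ 'n \<Rightarrow> (complex, 'n) mfps ^ 'n \<Rightarrow> bool"
  where
  "transforms_to F h N \<longleftrightarrow>
     (\<forall>k. (\<Sum>j\<in>UNIV. mfps_deriv j (mfps_X k + h $ k) * N $ j)
          = mfps_compose (F $ k) (\<chi> i. mfps_X i + h $ i))"

definition normalizing_transformation ::
    "complex ^ 'n \<Rightarrow> (complex, 'n::finite) mfps ^ 'n \<Rightarrow> (complex, 'n) mfps ^ 'n
      \<Rightarrow> (complex, 'n) mfps ^ 'n \<Rightarrow> bool"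
  where
  "normalizing_transformation lam F h N \<longleftrightarrow>
     (\<forall>k. starts_at 2 (h $ k)) \<and> transforms_to F h N \<and>
     (\<forall>k \<alpha>. mfps_nth ((N - linear_field lam) $ k) \<alpha> \<noteq> 0 \<longrightarrow> resonant lam k \<alpha>)"

definition distinguished_transformation ::
    "complex ^ 'n \<Rightarrow> (complex, 'n::finite) mfps ^ 'n \<Rightarrow> (complex, 'n) mfps ^ 'n
      \<Rightarrow> (complex, 'n) mfps ^ 'n \<Rightarrow> bool"
  where
  "distinguished_transformation lam F h N \<longleftrightarrow>
     normalizing_transformation lam F h N \<and>
     (\<forall>k \<alpha>. mfps_nth (h $ k) \<alpha> \<noteq> 0 \<longrightarrow> nonresonant lam k \<alpha>)"

definition distinguished_normal_form ::
    "complex ^ 'n \<Rightarrow> (complex, 'n::finite) mfps ^ 'n \<Rightarrow> (complex, 'n) mfps ^ 'n \<Rightarrow> bool"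
  where
  "distinguished_normal_form lam F N \<longleftrightarrow> (\<exists>h. distinguished_transformation lam F h N)"

definition first_integral ::
    "(complex, 'n::finite) mfps ^ 'n \<Rightarrow> (complex, 'n) mfps \<Rightarrow> bool" where
  "first_integral F \<Phi> \<longleftrightarrow> (\<Sum>i\<in>UNIV. F $ i * mfps_deriv i \<Phi>) = 0"

end

theory Submission
  imports Defs
begin

text \<open>
  Write the normal form as \<open>\<lambda>\<^sub>k y\<^sub>k + y\<^sub>k Y\<^sub>k(w)\<close> with \<open>w = y\<^sub>1 y\<^sub>2 y\<^sub>3\<close>. A formal first integral pulls back to one
  of the normal form, and its coefficients at the powers of \<open>w\<close> recursively force
  \<open>Y\<^sub>1 + Y\<^sub>2 + Y\<^sub>3 = 0\<close>. Conversely, under this condition \<open>w\<close> is a first integral of the normal form, so it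
  remains to see that the normalizing transformation converges. The divisors
  \<open>\<alpha>\<^sub>1 \<lambda>\<^sub>1 + \<alpha>\<^sub>2 \<lambda>\<^sub>2 + \<alpha>\<^sub>3 \<lambda>\<^sub>3 - \<lambda>\<^sub>k\<close> are Eisenstein integers, hence bounded below by 1, and the coefficients
  \<open>\<Sum>\<^sub>j \<alpha>\<^sub>j Y\<^sub>j\<close> of the derivative term in the homological equation depend only on the differences
  \<open>\<alpha>\<^sub>1 - \<alpha>\<^sub>3\<close> and \<open>\<alpha>\<^sub>2 - \<alpha>\<^sub>3\<close>, which are bounded by the divisor. Thus no derivative is lost, and an
  induction over truncations bounds the weighted coefficient sums at a fixed small radius.
\<close>

section \<open>Formal calculus\<close>

text \<open>Neither the normalizing transformation nor the normal form is known to converge in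
  advance, so their coefficients are estimated jointly. This is possible because \<open>h\<close>
  has no resonant terms: at a resonant index the homological equation determines only a coefficient
  of the normal form, at a nonresonant one only a coefficient of \<open>h\<close>. Resonant terms of
  \<open>h\<close> would be free parameters and could be chosen divergent.

  Sizes are measured on Taylor polynomials, where finiteness is no issue. Both nonlinear terms in
  degree N + 1 involve the unknowns only through degree N, which closes the induction. The two terms
  need different smallness: the product of normal form and \<open>h\<close> is controlled by a bound
  \<epsilon> on the normal form, fixed first; the term of the original system is quadratic in the
  radius \<rho> and becomes small against \<rho> times \<epsilon> once \<rho> is chosen after
  \<epsilon>.\<close>

lemma multi_index_induct [case_names zero add]:
  fixes \<alpha> :: "nat ^ 'n::finite"
  assumes "P 0" "\<And>\<alpha> i. P \<alpha> \<Longrightarrow> P (\<alpha> + axis i 1)"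
  shows "P \<alpha>"
proof (induction "mdeg \<alpha>" arbitrary: \<alpha>)
  case 0
  then show ?case using assms(1) by simp
next
  case (Suc d)
  then have "\<alpha> \<noteq> 0" by (metis mdeg_zero_iff nat.distinct(1))
  then obtain i where i: "\<alpha> $ i \<noteq> 0" by (auto simp: vec_eq_iff)
  define \<beta> where "\<beta> = (\<chi> j. if j = i then \<alpha> $ j - 1 else \<alpha> $ j)"
  have \<alpha>: "\<alpha> = \<beta> + axis i 1" using i by (auto simp: \<beta>_def vec_eq_iff axis_def)
  have "mdeg (axis i 1 :: nat ^ 'n) = 1" by (simp add: mdeg_def axis_def)
  then have "d = mdeg \<beta>" using Suc(2) by (simp add: \<alpha> mdeg_add)
  then show ?case using Suc(1) assms(2) \<alpha> by blast
qed

lemma mdeg_axis [simp]: "mdeg (axis i m :: nat ^ 'n::finite) = m"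
  by (simp add: mdeg_def axis_def)

section \<open>Monomials as series\<close>

definition mfps_monom :: "nat ^ 'n::finite \<Rightarrow> ('a::{zero, one}, 'n) mfps" where
  "mfps_monom \<alpha> = Abs_mfps (\<lambda>\<beta>. if \<beta> = \<alpha> then 1 else 0)"

abbreviation mpow :: "('a::comm_ring_1, 'n::finite) mfps ^ 'm::finite \<Rightarrow> nat ^ 'm \<Rightarrow> ('a, 'n) mfps" where
  "mpow z \<alpha> \<equiv> (\<Prod>i\<in>UNIV. (z $ i) ^ (\<alpha> $ i))"

lemma mpow_add: "mpow z (\<alpha> + \<beta>) = mpow z \<alpha> * mpow z \<beta>"
  by (simp add: power_add prod.distrib)

lemma mpow_axis [simp]: "mpow z (axis i (Suc 0)) = z $ i"
proof -
  have "mpow z (axis i 1) = (\<Prod>j\<in>UNIV. if j = i then z $ i else 1)"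
    by (rule prod.cong) (auto simp: axis_def)
  then show ?thesis by simp
qed

lemma mfps_nth_monom: "mfps_nth (mfps_monom \<alpha>) \<beta> = (if \<beta> = \<alpha> then 1 else 0)"
  by (simp add: mfps_monom_def)

lemma mfps_monom_0 [simp]: "mfps_monom 0 = 1"
  by (rule mfps_eqI) (simp add: mfps_nth_monom mfps_nth_one)

lemma mfps_monom_axis: "mfps_monom (axis i (Suc 0)) = mfps_X i"
  by (rule mfps_eqI) (simp add: mfps_nth_monom mfps_X_def)

lemma mfps_nth_sum: "mfps_nth (\<Sum>i\<in>I. f i) \<alpha> = (\<Sum>i\<in>I. mfps_nth (f i) \<alpha>)"
  by (induction I rule: infinite_finite_induct) auto

lemma mfps_nth_monom_mult:
  fixes f :: "('a::comm_ring_1, 'n::finite) mfps"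
  shows "mfps_nth (mfps_monom \<alpha> * f) (\<alpha> + \<beta>) = mfps_nth f \<beta>"
proof -
  have "mfps_nth (mfps_monom \<alpha> * f) (\<alpha> + \<beta>) =
      (\<Sum>x\<in>{(\<alpha>', \<beta>'). \<alpha>' + \<beta>' = \<alpha> + \<beta>}. if x = (\<alpha>, \<beta>) then mfps_nth f \<beta> else 0)"
    unfolding mfps_nth_mult by (rule sum.cong) (auto simp: mfps_nth_monom split: if_splits)
  also have "\<dots> = mfps_nth f \<beta>" by (subst sum.delta) auto
  finally show ?thesis .
qed

lemma mfps_nth_monom_mult_0:
  fixes f :: "('a::comm_ring_1, 'n::finite) mfps"
  assumes "\<And>\<beta>. \<gamma> \<noteq> \<alpha> + \<beta>"
  shows "mfps_nth (mfps_monom \<alpha> * f) \<gamma> = 0"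
  unfolding mfps_nth_mult using assms
  by (intro sum.neutral) (auto simp: mfps_nth_monom)

lemma mfps_monom_mult:
  "mfps_monom \<alpha> * mfps_monom \<beta> = (mfps_monom (\<alpha> + \<beta>) :: ('a::comm_ring_1, 'n::finite) mfps)"
proof (rule mfps_eqI)
  fix \<gamma> :: "nat ^ 'n"
  show "mfps_nth (mfps_monom \<alpha> * mfps_monom \<beta>) \<gamma> =
      mfps_nth (mfps_monom (\<alpha> + \<beta>) :: ('a, 'n) mfps) \<gamma>"
  proof (cases "\<exists>\<delta>. \<gamma> = \<alpha> + \<delta>")
    case True
    then show ?thesis by (auto simp: mfps_nth_monom_mult mfps_nth_monom)
  next
    case False
    then show ?thesis by (auto simp: mfps_nth_monom_mult_0 mfps_nth_monom)
  qed
qed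

lemma mfps_monom_add_axis:
  "(mfps_monom (\<alpha> + axis i (Suc 0)) :: ('a::comm_ring_1, 'n::finite) mfps) = mfps_monom \<alpha> * mfps_X i"
  by (simp add: mfps_monom_mult[symmetric] mfps_monom_axis)

lemma mfps_const_mult_nth [simp]:
  "mfps_nth (mfps_const c * f) \<gamma> = (c::'a::comm_ring_1) * mfps_nth f \<gamma>"
proof -
  have "mfps_nth (mfps_const c * f) \<gamma> =
      (\<Sum>x\<in>{(\<alpha>, \<beta>). \<alpha> + \<beta> = \<gamma>}. if x = (0, \<gamma>) then c * mfps_nth f \<gamma> else 0)"
    unfolding mfps_nth_mult by (rule sum.cong) (auto simp: mfps_const_def split: if_splits)
  also have "\<dots> = c * mfps_nth f \<gamma>" by (subst sum.delta) auto
  finally show ?thesis .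
qed

text \<open>The Euler operator is diagonal on monomials. Each component of the normal form carries a
  factor y_k, so derivation along it can be written with Euler operators and no index
  shifts.\<close>

lemma mfps_nth_X_deriv:
  "mfps_nth (mfps_X i * mfps_deriv i f) \<gamma> = of_nat (\<gamma> $ i) * mfps_nth f \<gamma>"
proof (cases "\<gamma> $ i = 0")
  case True
  have "\<gamma> \<noteq> axis i (Suc 0) + \<beta>" for \<beta>
    using True by (auto simp: vec_eq_iff axis_def intro!: exI[of _ i])
  then show ?thesis
    using True by (simp add: mfps_nth_monom_mult_0 flip: mfps_monom_axis)
next
  case False
  define \<beta> where "\<beta> = (\<chi> j. if j = i then \<gamma> $ j - 1 else \<gamma> $ j)"
  have \<gamma>: "\<gamma> = axis i (Suc 0) + \<beta>" using False by (auto simp: \<beta>_def vec_eq_iff axis_def)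
  have "\<gamma> $ i = \<beta> $ i + 1" using False by (simp add: \<beta>_def)
  moreover have "mfps_nth (mfps_X i * mfps_deriv i f) \<gamma> = mfps_nth (mfps_deriv i f) \<beta>"
    unfolding \<gamma> mfps_monom_axis[symmetric] by (rule mfps_nth_monom_mult)
  ultimately show ?thesis
    by (simp add: mfps_deriv_def add.commute[of \<beta>] flip: \<gamma>)
qed

subsection \<open>Orders\<close>

lemma starts_at_mono: "starts_at d f \<Longrightarrow> e \<le> d \<Longrightarrow> starts_at e f"
  by (auto simp: starts_at_def)

lemma starts_at_SucD: "starts_at (Suc d) f \<Longrightarrow> starts_at d f"
  by (simp add: starts_at_def)

lemma starts_at_zero [simp]: "starts_at d 0"
  by (simp add: starts_at_def)

lemma starts_at_add: "starts_at d f \<Longrightarrow> starts_at d g \<Longrightarrow> starts_at d (f + g)"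
  for f :: "('a::comm_ring_1, 'n::finite) mfps"
  by (simp add: starts_at_def)

lemma starts_at_diff: "starts_at d f \<Longrightarrow> starts_at d g \<Longrightarrow> starts_at d (f - g)"
  for f :: "('a::comm_ring_1, 'n::finite) mfps"
  by (simp add: starts_at_def)

lemma starts_at_uminus [simp]: "starts_at d (- f) \<longleftrightarrow> starts_at d f"
  for f :: "('a::comm_ring_1, 'n::finite) mfps"
  by (simp add: starts_at_def)

lemma starts_at_sum: "(\<And>i. i \<in> I \<Longrightarrow> starts_at d (f i)) \<Longrightarrow> starts_at d (\<Sum>i\<in>I. f i)"
  for f :: "'b \<Rightarrow> ('a::comm_ring_1, 'n::finite) mfps"
  by (simp add: starts_at_def mfps_nth_sum)

lemma starts_at_mult_left: "starts_at d f \<Longrightarrow> starts_at d (f * g)"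
  for f :: "('a::comm_ring_1, 'n::finite) mfps"
  using starts_at_mult[of d f 0 g] by simp

lemma starts_at_mult_right: "starts_at d f \<Longrightarrow> starts_at d (g * f)"
  for f :: "('a::comm_ring_1, 'n::finite) mfps"
  using starts_at_mult[of 0 g d f] by simp

lemma starts_at_X [simp]: "starts_at (Suc 0) (mfps_X i)"
  by (auto simp: starts_at_def mfps_X_def)

lemma starts_at_deriv: "starts_at (Suc d) f \<Longrightarrow> starts_at d (mfps_deriv i f)"
  by (simp add: starts_at_def mfps_deriv_def mdeg_add)

lemma starts_at_all_imp_zero: "(\<And>d. starts_at d f) \<Longrightarrow> f = 0"
  by (rule mfps_eqI) (auto simp: starts_at_def)

text \<open>Linear operators that are continuous for the order topology are determined by their values on
  monomials; multiplicativity of substitution, the product and chain rules and the associativity of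
  substitution are all checked in this way.\<close>

lemma mfps_linear_ext:
  fixes A B :: "('a::comm_ring_1, 'm::finite) mfps \<Rightarrow> ('a, 'n::finite) mfps"
  assumes A: "\<And>f g. A (f + g) = A f + A g" "\<And>c f. A (mfps_const c * f) = mfps_const c * A f"
      "\<And>d f. starts_at (Suc d) f \<Longrightarrow> starts_at d (A f)"
    and B: "\<And>f g. B (f + g) = B f + B g" "\<And>c f. B (mfps_const c * f) = mfps_const c * B f"
      "\<And>d f. starts_at (Suc d) f \<Longrightarrow> starts_at d (B f)"
    and AB: "\<And>\<alpha>. A (mfps_monom \<alpha>) = B (mfps_monom \<alpha>)"
  shows "A f = B f"
proof -
  have zero: "A 0 = 0" "B 0 = 0" using A(1)[of 0 0] B(1)[of 0 0] by auto
  have "starts_at d (A f - B f)" for d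
  proof -
    define T where "T = (\<Sum>\<alpha> | mdeg \<alpha> \<le> d. mfps_const (mfps_nth f \<alpha>) * mfps_monom \<alpha>)"
    have "A (\<Sum>\<alpha>\<in>I. mfps_const (mfps_nth f \<alpha>) * mfps_monom \<alpha>) =
        B (\<Sum>\<alpha>\<in>I. mfps_const (mfps_nth f \<alpha>) * mfps_monom \<alpha>)" for I
      by (induction I rule: infinite_finite_induct) (simp_all add: zero A B AB)
    then have T: "A T = B T" unfolding T_def .
    \<comment> \<open>\<open>A\<close> and \<open>B\<close> may lower the order by one, as a
      derivative does; hence the truncation goes one degree beyond what is to be compared.\<close>
    have "starts_at (Suc d) (f - T)"
      by (auto simp: starts_at_def T_def mfps_nth_sum mfps_nth_monom if_distrib[of "(*) _"]
          sum.delta' less_Suc_eq_le cong: if_cong)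
    then have "starts_at d (A (f - T) - B (f - T))" by (intro starts_at_diff[OF A(3) B(3)])
    moreover have "A f = A (f - T) + A T" "B f = B (f - T) + B T"
      using A(1)[of "f - T" T] B(1)[of "f - T" T] by auto
    ultimately show ?thesis using T by simp
  qed
  then show ?thesis using starts_at_all_imp_zero[of "A f - B f"] by simp
qed

subsection \<open>Derivatives\<close>

lemma mfps_deriv_add: "mfps_deriv i (f + g) = mfps_deriv i f + mfps_deriv i g"
  by (rule mfps_eqI) (simp add: mfps_deriv_def algebra_simps)

lemma mfps_deriv_const_mult: "mfps_deriv i (mfps_const c * f) = mfps_const c * mfps_deriv i f"
  by (rule mfps_eqI) (simp add: mfps_deriv_def mult.left_commute del: of_nat_Suc of_nat_add)

lemma mfps_deriv_X: "mfps_deriv i (mfps_X j) = (if i = j then 1 else 0)"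
proof (rule mfps_eqI)
  fix \<alpha> :: "nat ^ 'b"
  have "\<alpha> + axis i (Suc 0) = axis j (Suc 0) \<longleftrightarrow> i = j \<and> \<alpha> = 0"
  proof
    assume eq: "\<alpha> + axis i (Suc 0) = axis j (Suc 0)"
    then have "(\<alpha> + axis i (Suc 0)) $ i = axis j (Suc 0) $ i" by simp
    then have "i = j" by (auto simp: axis_def split: if_splits)
    with eq show "i = j \<and> \<alpha> = 0" by simp
  qed simp
  then show "mfps_nth (mfps_deriv i (mfps_X j)) \<alpha> = mfps_nth (if i = j then 1 else 0 :: ('a, 'b) mfps) \<alpha>"
    by (auto simp: mfps_deriv_def mfps_X_def mfps_nth_one)
qed

lemma mfps_deriv_monom:
  "mfps_deriv i (mfps_monom \<alpha>) =
     (mfps_const (of_nat (\<alpha> $ i)) * mfps_monom (\<alpha> - axis i 1) :: ('a::comm_ring_1, 'n::finite) mfps)"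
proof (rule mfps_eqI)
  fix \<beta> :: "nat ^ 'n"
  have "\<beta> + axis i (Suc 0) = \<alpha> \<longleftrightarrow> \<alpha> $ i \<noteq> 0 \<and> \<beta> = \<alpha> - axis i (Suc 0)"
    by (auto simp: vec_eq_iff axis_def)
  moreover have "\<beta> = \<alpha> - axis i (Suc 0) \<Longrightarrow> \<alpha> $ i \<noteq> 0 \<Longrightarrow> Suc (\<beta> $ i) = \<alpha> $ i"
    by (simp add: axis_def)
  ultimately show "mfps_nth (mfps_deriv i (mfps_monom \<alpha>) :: ('a, 'n) mfps) \<beta> =
      mfps_nth (mfps_const (of_nat (\<alpha> $ i)) * mfps_monom (\<alpha> - axis i 1)) \<beta>"
    by (auto simp: mfps_deriv_def mfps_nth_monom simp flip: of_nat_Suc)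
qed

text \<open>Both sides are bilinear, so the extension principle is applied twice: in
  \<open>g\<close> with a monomial for \<open>f\<close>, then in \<open>f\<close>. For two monomials
  the rule is additivity of exponents.\<close>

lemma mfps_deriv_mult:
  fixes f g :: "('a::comm_ring_1, 'n::finite) mfps"
  shows "mfps_deriv i (f * g) = mfps_deriv i f * g + f * mfps_deriv i g"
proof -
  have monom: "mfps_deriv i (mfps_monom \<alpha> * mfps_monom \<beta>) =
      (mfps_deriv i (mfps_monom \<alpha>) * mfps_monom \<beta> + mfps_monom \<alpha> * mfps_deriv i (mfps_monom \<beta>)
        :: ('a, 'n) mfps)" for \<alpha> \<beta>
  proof -
    \<comment> \<open>Subtraction of exponents is truncated; when it would truncate, the scalar in
      front is zero.\<close>
    have *: "mfps_const (of_nat (\<alpha> $ i)) * mfps_monom (\<alpha> - axis i 1) * mfps_monom \<beta> =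
        (mfps_const (of_nat (\<alpha> $ i)) * mfps_monom (\<alpha> + \<beta> - axis i 1) :: ('a, 'n) mfps)" for \<alpha> \<beta>
    proof (cases "\<alpha> $ i = 0")
      case False
      then have "\<alpha> - axis i 1 + \<beta> = \<alpha> + \<beta> - axis i 1"
        by (auto simp: vec_eq_iff axis_def)
      then show ?thesis by (simp add: mult.assoc mfps_monom_mult)
    qed (simp add: mfps_eq_iff mult.assoc)
    have const_add: "mfps_const (x + y) = (mfps_const x + mfps_const y :: ('a, 'n) mfps)" for x y
      by (rule mfps_eqI) (simp add: mfps_const_def)
    have "mfps_monom \<alpha> * mfps_deriv i (mfps_monom \<beta>) =
        (mfps_const (of_nat (\<beta> $ i)) * mfps_monom (\<alpha> + \<beta> - axis i 1) :: ('a, 'n) mfps)"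
      using *[of \<beta> \<alpha>] by (simp add: mfps_deriv_monom add.commute mult.commute)
    moreover have "mfps_deriv i (mfps_monom \<alpha>) * mfps_monom \<beta> =
        (mfps_const (of_nat (\<alpha> $ i)) * mfps_monom (\<alpha> + \<beta> - axis i 1) :: ('a, 'n) mfps)"
      using *[of \<alpha> \<beta>] by (simp add: mfps_deriv_monom)
    ultimately show ?thesis
      by (simp add: mfps_monom_mult mfps_deriv_monom const_add distrib_right)
  qed
  note distribs = mfps_deriv_add mfps_deriv_const_mult distrib_left distrib_right
  note const_left = mult.left_commute[where a = "mfps_const c" for c]
  have orders: "starts_at d (mfps_deriv i (f * g))" "starts_at d (mfps_deriv i f * g + f * mfps_deriv i g)"
    if "starts_at (Suc d) f \<or> starts_at (Suc d) g" for d and f g :: "('a, 'n) mfps"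
  proof -
    have "starts_at (Suc d) (f * g)"
      using that by (auto intro: starts_at_mult_left starts_at_mult_right)
    then show "starts_at d (mfps_deriv i (f * g))" by (rule starts_at_deriv)
    from that show "starts_at d (mfps_deriv i f * g + f * mfps_deriv i g)"
      by (auto intro!: starts_at_add
          intro: starts_at_mult_left[OF starts_at_deriv] starts_at_mult_right[OF starts_at_deriv]
            starts_at_mult_left[OF starts_at_SucD] starts_at_mult_right[OF starts_at_SucD])
  qed
  have *: "mfps_deriv i (mfps_monom \<alpha> * g) =
      mfps_deriv i (mfps_monom \<alpha>) * g + mfps_monom \<alpha> * mfps_deriv i g" for \<alpha>
    by (rule mfps_linear_ext[of "\<lambda>g. mfps_deriv i (mfps_monom \<alpha> * g)"])
       (simp_all add: distribs const_left[of "mfps_monom \<alpha>"] const_left[of "mfps_deriv i (mfps_monom \<alpha>)"]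
          orders monom)
  show ?thesis
    by (rule mfps_linear_ext[of "\<lambda>f. mfps_deriv i (f * g)"])
       (simp_all add: distribs mult.assoc orders *)
qed

lemma mfps_deriv_1 [simp]: "mfps_deriv i 1 = 0"
  using mfps_deriv_mult[of i 1 1] by simp

subsection \<open>Substitution\<close>

lemma mfps_compose_add: "mfps_compose (f + g) z = mfps_compose f z + mfps_compose g z"
  by (rule mfps_eqI) (simp add: mfps_compose_def distrib_right sum.distrib)

lemma mfps_compose_const_mult: "mfps_compose (mfps_const c * f) z = mfps_const c * mfps_compose f z"
  by (rule mfps_eqI) (simp add: mfps_compose_def mult.assoc sum_distrib_left)

lemma mfps_compose_zero [simp]: "mfps_compose 0 z = 0"
  by (rule mfps_eqI) (simp add: mfps_compose_def)

lemma mfps_compose_sum: "mfps_compose (\<Sum>i\<in>I. f i) z = (\<Sum>i\<in>I. mfps_compose (f i) z)"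
  by (induction I rule: infinite_finite_induct) (auto simp: mfps_compose_add)

lemma starts_at_compose:
  fixes f :: "('a::comm_ring_1, 'm::finite) mfps" and z :: "('a, 'n::finite) mfps ^ 'm"
  shows "starts_at d f \<Longrightarrow> starts_at d (mfps_compose f z)"
  unfolding starts_at_def mfps_compose_def mfps_nth_Abs
proof (intro allI impI sum.neutral ballI)
  fix \<gamma> :: "nat ^ 'n" and \<alpha> :: "nat ^ 'm"
  assume f: "\<forall>\<alpha>. mdeg \<alpha> < d \<longrightarrow> mfps_nth f \<alpha> = 0" and "mdeg \<gamma> < d" "\<alpha> \<in> {\<alpha>. mdeg \<alpha> \<le> mdeg \<gamma>}"
  then have "mfps_nth f \<alpha> = 0" by simp
  then show "mfps_nth f \<alpha> * mfps_nth (mpow z \<alpha>) \<gamma> = 0" by simp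
qed

text \<open>Raising the cutoff only adds zeros, since the power product with exponent \<alpha> has
  order at least \<open>mdeg \<alpha>\<close>. One cutoff valid for all \<gamma> of bounded degree
  makes it possible to exchange sums over \<gamma> and \<alpha>.\<close>

lemma mfps_compose_nth:
  assumes "\<And>i. starts_at 1 (z $ i)" "mdeg \<gamma> \<le> D"
  shows "mfps_nth (mfps_compose f z) \<gamma> = (\<Sum>\<alpha> | mdeg \<alpha> \<le> D. mfps_nth f \<alpha> * mfps_nth (mpow z \<alpha>) \<gamma>)"
  unfolding mfps_compose_def mfps_nth_Abs
proof (rule sum.mono_neutral_left)
  show "\<forall>\<alpha>\<in>{\<alpha>. mdeg \<alpha> \<le> D} - {\<alpha>. mdeg \<alpha> \<le> mdeg \<gamma>}. mfps_nth f \<alpha> * mfps_nth (mpow z \<alpha>) \<gamma> = 0"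
    using starts_at_monomial[OF assms(1)] by (auto simp: starts_at_def)
qed (use assms in auto)

lemma mfps_compose_monom:
  assumes "\<And>i. starts_at 1 (z $ i)"
  shows "mfps_compose (mfps_monom \<alpha>) z = mpow z \<alpha>"
proof (rule mfps_eqI)
  fix \<gamma>
  \<comment> \<open>This cutoff is admissible for \<gamma> and large enough to include \<alpha>
    itself.\<close>
  have "mfps_nth (mfps_compose (mfps_monom \<alpha>) z) \<gamma> = (\<Sum>\<beta> | mdeg \<beta> \<le> mdeg \<alpha> + mdeg \<gamma>.
      mfps_nth (mfps_monom \<alpha>) \<beta> * mfps_nth (mpow z \<beta>) \<gamma>)"
    by (rule mfps_compose_nth[OF assms]) simp
  also have "\<dots> = (\<Sum>\<beta> | mdeg \<beta> \<le> mdeg \<alpha> + mdeg \<gamma>.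
      if \<beta> = \<alpha> then mfps_nth (mpow z \<alpha>) \<gamma> else 0)"
    by (rule sum.cong) (simp_all add: mfps_nth_monom)
  also have "\<dots> = mfps_nth (mpow z \<alpha>) \<gamma>" by simp
  finally show "mfps_nth (mfps_compose (mfps_monom \<alpha>) z) \<gamma> = mfps_nth (mpow z \<alpha>) \<gamma>" .
qed

context
  fixes z :: "('a::comm_ring_1, 'n::finite) mfps ^ 'm::finite"
  assumes z: "\<And>i. starts_at 1 (z $ i)"
begin

lemma mfps_compose_1: "mfps_compose 1 z = 1"
  using mfps_compose_monom[OF z, of 0] by simp

lemma mfps_compose_X: "mfps_compose (mfps_X i) z = z $ i"
  using mfps_compose_monom[OF z, of "axis i 1"] by (simp add: mfps_monom_axis)

lemma mfps_compose_mult: "mfps_compose (f * g) z = mfps_compose f z * mfps_compose g z"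
proof -
  note distribs = mfps_compose_add mfps_compose_const_mult distrib_left distrib_right
  note const_left = mult.left_commute[where a = "mfps_const c" for c]
  have orders: "starts_at d (mfps_compose (f * g) z)"
      "starts_at d (mfps_compose f z * mfps_compose g z)"
    if "starts_at (Suc d) f \<or> starts_at (Suc d) g" for d f g
  proof -
    have *: "starts_at d f \<or> starts_at d g" using that starts_at_SucD by auto
    then show "starts_at d (mfps_compose (f * g) z)"
      by (auto intro: starts_at_compose starts_at_mult_left starts_at_mult_right)
    from * show "starts_at d (mfps_compose f z * mfps_compose g z)"
      by (auto intro: starts_at_compose starts_at_mult_left starts_at_mult_right)
  qed
  have monom: "mfps_compose (mfps_monom \<alpha> * mfps_monom \<beta>) z =
      mfps_compose (mfps_monom \<alpha>) z * mfps_compose (mfps_monom \<beta>) z" for \<alpha> \<beta>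
    by (simp add: mfps_monom_mult mfps_compose_monom[OF z] power_add prod.distrib)
  have *: "mfps_compose (mfps_monom \<alpha> * g) z = mfps_compose (mfps_monom \<alpha>) z * mfps_compose g z" for \<alpha>
    by (rule mfps_linear_ext[of "\<lambda>g. mfps_compose (mfps_monom \<alpha> * g) z"])
       (simp_all add: distribs const_left[of "mfps_monom \<alpha>"] const_left[of "mfps_compose (mfps_monom \<alpha>) z"]
          orders monom)
  show ?thesis
    by (rule mfps_linear_ext[of "\<lambda>f. mfps_compose (f * g) z"])
       (simp_all add: distribs mult.assoc orders *)
qed

lemma mfps_compose_power: "mfps_compose (f ^ k) z = mfps_compose f z ^ k"
  by (induction k) (auto simp: mfps_compose_1 mfps_compose_mult)

lemma mfps_compose_prod: "mfps_compose (\<Prod>i\<in>I. f i) z = (\<Prod>i\<in>I. mfps_compose (f i) z)"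
  by (induction I rule: infinite_finite_induct) (auto simp: mfps_compose_1 mfps_compose_mult)

lemma mfps_compose_assoc:
  assumes y: "\<And>i. starts_at 1 (y $ i)"
  shows "mfps_compose (mfps_compose f y) z = mfps_compose f (\<chi> i. mfps_compose (y $ i) z)"
proof (rule mfps_linear_ext[of "\<lambda>f. mfps_compose (mfps_compose f y) z"])
  have "starts_at 1 ((\<chi> i. mfps_compose (y $ i) z) $ i)" for i
    using y by (simp add: starts_at_compose)
  then show "mfps_compose (mfps_compose (mfps_monom \<alpha>) y) z =
      mfps_compose (mfps_monom \<alpha>) (\<chi> i. mfps_compose (y $ i) z)" for \<alpha>
    using y by (simp add: mfps_compose_monom mfps_compose_prod mfps_compose_power)
qed (auto simp: mfps_compose_add mfps_compose_const_mult
      intro!: starts_at_compose dest: starts_at_SucD)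

lemma mfps_deriv_compose:
  "mfps_deriv j (mfps_compose f z) =
     (\<Sum>k\<in>UNIV. mfps_compose (mfps_deriv k f) z * mfps_deriv j (z $ k))"
proof (rule mfps_linear_ext[of "\<lambda>f. mfps_deriv j (mfps_compose f z)"])
  fix \<alpha> :: "nat ^ 'm"
  show "mfps_deriv j (mfps_compose (mfps_monom \<alpha>) z) =
     (\<Sum>k\<in>UNIV. mfps_compose (mfps_deriv k (mfps_monom \<alpha>)) z * mfps_deriv j (z $ k))"
  proof (induction \<alpha> rule: multi_index_induct)
    case zero
    show ?case by (simp add: mfps_compose_1)
  next
    case (add \<alpha> i)
    have "(\<Sum>k\<in>UNIV. mfps_compose (mfps_monom \<alpha>) z * mfps_compose (mfps_deriv k (mfps_X i)) z
          * mfps_deriv j (z $ k)) =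
        (\<Sum>k\<in>UNIV. if k = i then mfps_compose (mfps_monom \<alpha>) z * mfps_deriv j (z $ i) else 0)"
      by (rule sum.cong) (auto simp: mfps_deriv_X mfps_compose_1)
    then have *: "mfps_compose (mfps_monom \<alpha>) z * mfps_deriv j (z $ i) =
        (\<Sum>k\<in>UNIV. mfps_compose (mfps_monom \<alpha>) z * mfps_compose (mfps_deriv k (mfps_X i)) z
          * mfps_deriv j (z $ k))" by simp
    have "mfps_deriv j (mfps_compose (mfps_monom (\<alpha> + axis i 1)) z) =
        mfps_deriv j (mfps_compose (mfps_monom \<alpha>) z) * z $ i
        + mfps_compose (mfps_monom \<alpha>) z * mfps_deriv j (z $ i)"
      by (simp add: mfps_monom_add_axis mfps_deriv_mult mfps_compose_mult mfps_compose_X)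
    also have "\<dots> = (\<Sum>k\<in>UNIV. mfps_compose (mfps_deriv k (mfps_monom (\<alpha> + axis i 1))) z
        * mfps_deriv j (z $ k))"
      unfolding add * sum_distrib_right sum.distrib[symmetric]
      by (rule sum.cong) (simp_all add: mfps_monom_add_axis mfps_deriv_mult mfps_compose_add
          mfps_compose_mult mfps_compose_X algebra_simps)
    finally show ?case .
  qed
qed (auto simp: mfps_compose_add mfps_compose_const_mult mfps_deriv_add mfps_deriv_const_mult
      distrib_right sum.distrib sum_distrib_left mult.assoc
      intro!: starts_at_deriv starts_at_compose starts_at_sum starts_at_mult_left)

end

lemma mfps_compose_ident:
  fixes f :: "('b::comm_ring_1, 'a::finite) mfps"
  shows "mfps_compose f (\<chi> i. mfps_X i) = f"
proof (rule mfps_linear_ext[of "\<lambda>f. mfps_compose f (\<chi> i. mfps_X i)"])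
  fix \<alpha> :: "nat ^ 'a"
  have "mpow (\<chi> i. mfps_X i) \<alpha> = (mfps_monom \<alpha> :: ('b, 'a) mfps)"
  proof (induction \<alpha> rule: multi_index_induct)
    case (add \<alpha> i)
    then show ?case
      using mpow_add[of "(\<chi> i. mfps_X i) :: ('b, 'a) mfps ^ 'a" \<alpha> "axis i 1"]
        mpow_axis[of "(\<chi> i. mfps_X i) :: ('b, 'a) mfps ^ 'a" i]
      by (simp add: mfps_monom_add_axis)
  qed simp
  then show "mfps_compose (mfps_monom \<alpha>) (\<chi> i. mfps_X i) = (mfps_monom \<alpha> :: ('b, 'a) mfps)"
    by (subst mfps_compose_monom) auto
qed (auto simp: mfps_compose_add mfps_compose_const_mult
      intro!: starts_at_compose dest: starts_at_SucD)

text \<open>Telescoping: replace one factor at a time. Every factor that is kept contributes order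
  one, the replaced one order n + 1.\<close>

lemma starts_at_mpow_diff:
  assumes "\<And>i. starts_at 1 (y $ i)" "\<And>i. starts_at 1 (z $ i)" "\<And>i. starts_at (Suc n) (y $ i - z $ i)"
  shows "starts_at (n + mdeg \<alpha>) (mpow y \<alpha> - mpow z \<alpha>)"
proof (induction \<alpha> rule: multi_index_induct)
  case (add \<alpha> i)
  have "mpow y (\<alpha> + axis i 1) - mpow z (\<alpha> + axis i 1) =
      (mpow y \<alpha> - mpow z \<alpha>) * y $ i + mpow z \<alpha> * (y $ i - z $ i)"
    unfolding mpow_add using mpow_axis[of y i] mpow_axis[of z i] by (simp add: algebra_simps)
  moreover have "starts_at (n + mdeg \<alpha> + 1) ((mpow y \<alpha> - mpow z \<alpha>) * y $ i)"
    by (intro starts_at_mult add assms)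
  moreover have "starts_at (mdeg \<alpha> + Suc n) (mpow z \<alpha> * (y $ i - z $ i))"
    by (intro starts_at_mult starts_at_monomial assms)
  ultimately show ?case by (simp add: mdeg_add starts_at_add add.commute)
qed simp

text \<open>For m = 2 this is a contraction: substitution into a series without linear part improves
  the order of agreement by one. For n = 1 and m = 3 it says that a near-identity substitution
  leaves the cubic part alone.\<close>

lemma starts_at_compose_diff:
  fixes f :: "('a::comm_ring_1, 'm::finite) mfps" and y z :: "('a, 'n::finite) mfps ^ 'm"
  assumes yz: "\<And>i. starts_at 1 (y $ i)" "\<And>i. starts_at 1 (z $ i)"
      "\<And>i. starts_at (Suc n) (y $ i - z $ i)"
    and f: "starts_at m f"
  shows "starts_at (n + m) (mfps_compose f y - mfps_compose f z)"
  unfolding starts_at_def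
proof (intro allI impI)
  fix \<gamma> :: "nat ^ 'n" assume \<gamma>: "mdeg \<gamma> < n + m"
  have "mfps_nth (mfps_compose f y - mfps_compose f z) \<gamma> =
      (\<Sum>\<alpha> | mdeg \<alpha> \<le> mdeg \<gamma>. mfps_nth f \<alpha> * mfps_nth (mpow y \<alpha> - mpow z \<alpha>) \<gamma>)"
    by (simp add: mfps_compose_def sum_subtractf[symmetric] right_diff_distrib)
  also have "\<dots> = 0"
  proof (intro sum.neutral ballI)
    fix \<alpha> :: "nat ^ 'm"
    show "mfps_nth f \<alpha> * mfps_nth (mpow y \<alpha> - mpow z \<alpha>) \<gamma> = 0"
    proof (cases "mdeg \<alpha> < m")
      case False
      then have "mdeg \<gamma> < n + mdeg \<alpha>" using \<gamma> by simp
      then show ?thesis using starts_at_mpow_diff[OF yz, of \<alpha>] unfolding starts_at_def by simp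
    qed (use f in \<open>simp add: starts_at_def\<close>)
  qed
  finally show "mfps_nth (mfps_compose f y - mfps_compose f z) \<gamma> = 0" .
qed

section \<open>Formal inverses of near-identity substitutions\<close>

lemma starts_at_X_add:
  "starts_at 2 f \<Longrightarrow> starts_at 1 (mfps_X i + f)" for f :: "('a::comm_ring_1, 'n::finite) mfps"
  by (auto intro!: starts_at_add intro: starts_at_mono)

context
  fixes h :: "('a::comm_ring_1, 'n::finite) mfps ^ 'n"
  assumes h: "\<And>k. starts_at 2 (h $ k)"
begin

text \<open>Picard iteration for g = -h(y + g(y)), the equation expressing that y + g(y) is a right
  inverse of x + h(x).\<close>

primrec inverse_approx :: "nat \<Rightarrow> ('a, 'n) mfps ^ 'n" where
  "inverse_approx 0 = 0"
| "inverse_approx (Suc n) = (\<chi> k. - mfps_compose (h $ k) (\<chi> i. mfps_X i + inverse_approx n $ i))"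

lemma starts_at_inverse_approx: "starts_at 2 (inverse_approx n $ k)"
  by (cases n) (auto intro: starts_at_compose h)

lemma inverse_approx_diff: "starts_at (n + 2) (inverse_approx (Suc n) $ k - inverse_approx n $ k)"
proof (induction n arbitrary: k)
  case 0
  show ?case using starts_at_inverse_approx[of "Suc 0" k] by (simp add: numeral_2_eq_2)
next
  case (Suc n)
  have "starts_at (Suc n + 2)
     (mfps_compose (h $ k) (\<chi> i. mfps_X i + inverse_approx n $ i)
      - mfps_compose (h $ k) (\<chi> i. mfps_X i + inverse_approx (Suc n) $ i))"
  proof (rule starts_at_compose_diff)
    fix i
    have "starts_at (n + 2) (- (inverse_approx (Suc n) $ i - inverse_approx n $ i))"
      using Suc[of i] by (simp only: starts_at_uminus)
    then show "starts_at (Suc (Suc n)) ((\<chi> i. mfps_X i + inverse_approx n $ i) $ i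
        - (\<chi> i. mfps_X i + inverse_approx (Suc n) $ i) $ i)"
      by simp
  qed (simp_all only: vec_lambda_beta starts_at_X_add starts_at_inverse_approx h)
  then show ?case by simp
qed

lemma inverse_approx_diff_le:
  "starts_at (n + 2) (inverse_approx (n + m) $ k - inverse_approx n $ k)"
proof (induction m)
  case (Suc m)
  have "starts_at (n + 2) (inverse_approx (Suc (n + m)) $ k - inverse_approx (n + m) $ k)"
    by (rule starts_at_mono[OF inverse_approx_diff]) simp
  from starts_at_add[OF this Suc] show ?case by (simp del: inverse_approx.simps)
qed simp

lemma inverse_fixpoint:
  obtains g where "\<And>k. starts_at 2 (g $ k)"
    "\<And>k. g $ k = - mfps_compose (h $ k) (\<chi> i. mfps_X i + g $ i)"
proof
  \<comment> \<open>Iterate n already has the final coefficients through degree n + 1, so the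
    coefficient at \<alpha> can be read off from iterate \<open>mdeg \<alpha>\<close>.\<close>
  define g where "g = (\<chi> k. Abs_mfps (\<lambda>\<alpha>. mfps_nth (inverse_approx (mdeg \<alpha>) $ k) \<alpha>))"
  have approx: "starts_at (Suc n) (g $ k - inverse_approx n $ k)" for n k
    unfolding starts_at_def
  proof (intro allI impI)
    fix \<alpha> :: "nat ^ 'n" assume "mdeg \<alpha> < Suc n"
    then obtain m where "n = mdeg \<alpha> + m" using less_Suc_eq_le le_Suc_ex by blast
    with inverse_approx_diff_le[of "mdeg \<alpha>" m k]
    show "mfps_nth (g $ k - inverse_approx n $ k) \<alpha> = 0"
      by (simp add: g_def starts_at_def)
  qed
  show g: "starts_at 2 (g $ k)" for k
    using starts_at_inverse_approx by (simp add: starts_at_def g_def)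
  show "g $ k = - mfps_compose (h $ k) (\<chi> i. mfps_X i + g $ i)" for k
  proof -
    have "starts_at d (g $ k + mfps_compose (h $ k) (\<chi> i. mfps_X i + g $ i))" for d
    proof -
      have "starts_at (d + 2) (mfps_compose (h $ k) (\<chi> i. mfps_X i + g $ i)
          - mfps_compose (h $ k) (\<chi> i. mfps_X i + inverse_approx d $ i))"
        using approx[of d]
        by (intro starts_at_compose_diff)
           (simp_all only: vec_lambda_beta starts_at_X_add starts_at_inverse_approx g h add_diff_cancel_left)
      from starts_at_mono[OF this, of d] starts_at_mono[OF approx[of "Suc d" k], of d]
      have "starts_at d ((g $ k - inverse_approx (Suc d) $ k)
          + (mfps_compose (h $ k) (\<chi> i. mfps_X i + g $ i)
            - mfps_compose (h $ k) (\<chi> i. mfps_X i + inverse_approx d $ i)))"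
        by (intro starts_at_add) simp_all
      then show ?thesis by simp
    qed
    then show ?thesis using starts_at_all_imp_zero eq_neg_iff_add_eq_0 by blast
  qed
qed

lemma inverse_fixpoint_right_inverse:
  assumes g: "\<And>k. starts_at 2 (g $ k)"
      "\<And>k. g $ k = - mfps_compose (h $ k) (\<chi> i. mfps_X i + g $ i)"
  shows "mfps_compose (mfps_X k + h $ k) (\<chi> i. mfps_X i + g $ i) = mfps_X k"
proof -
  have "mfps_compose (mfps_X k) (\<chi> i. mfps_X i + g $ i) = mfps_X k + g $ k"
    by (subst mfps_compose_X) (simp_all only: vec_lambda_beta starts_at_X_add g(1))
  then show ?thesis using g(2)[of k] by (simp add: mfps_compose_add)
qed

end

text \<open>The group argument: the right inverse has itself a right inverse, and associativity
  identifies the latter with the original substitution.\<close>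

lemma inverse_fixpoint_left_inverse:
  fixes h g :: "('a::comm_ring_1, 'n::finite) mfps ^ 'n"
  assumes h: "\<And>k. starts_at 2 (h $ k)" and g: "\<And>k. starts_at 2 (g $ k)"
    and gh: "\<And>k. g $ k = - mfps_compose (h $ k) (\<chi> i. mfps_X i + g $ i)"
  shows "mfps_compose (mfps_X k + g $ k) (\<chi> i. mfps_X i + h $ i) = mfps_X k"
proof -
  obtain h' where h': "\<And>k. starts_at 2 (h' $ k)"
    and "\<And>k. h' $ k = - mfps_compose (g $ k) (\<chi> i. mfps_X i + h' $ i)"
    using inverse_fixpoint[OF g] by blast
  then have r: "mfps_compose (mfps_X k + g $ k) (\<chi> i. mfps_X i + h' $ i) = mfps_X k" for k
    by (intro inverse_fixpoint_right_inverse g)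
  have "mfps_X k + h $ k = mfps_X k + h' $ k" for k
  proof -
    have "mfps_X k + h $ k =
        mfps_compose (mfps_X k + h $ k) (\<chi> j. mfps_compose ((\<chi> i. mfps_X i + g $ i) $ j) (\<chi> i. mfps_X i + h' $ i))"
      by (simp add: r mfps_compose_ident)
    also have "\<dots> = mfps_compose (mfps_compose (mfps_X k + h $ k) (\<chi> i. mfps_X i + g $ i)) (\<chi> i. mfps_X i + h' $ i)"
      by (rule mfps_compose_assoc[symmetric]) (simp_all only: vec_lambda_beta starts_at_X_add g h')
    also have "\<dots> = mfps_compose (mfps_X k) (\<chi> i. mfps_X i + h' $ i)"
      by (simp only: inverse_fixpoint_right_inverse[OF h g gh])
    also have "\<dots> = mfps_X k + h' $ k"
      by (subst mfps_compose_X) (simp_all only: vec_lambda_beta starts_at_X_add h')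
    finally show ?thesis .
  qed
  then have "(\<chi> i. mfps_X i + h $ i) = (\<chi> i. mfps_X i + h' $ i)" by (simp only:)
  then show ?thesis using r by simp
qed

section \<open>Truncated majorant norms\<close>

text \<open>A factor of order b leaves at most N - b of the total degree to the other one. This
  shortening of the ranges is the source of every gain of a degree below.\<close>

lemma sum_convolution_le:
  fixes u v :: "nat ^ 'n::finite \<Rightarrow> real"
  assumes nonneg: "\<And>\<alpha>. 0 \<le> u \<alpha>" "\<And>\<alpha>. 0 \<le> v \<alpha>"
    and order: "\<And>\<alpha>. mdeg \<alpha> < a \<Longrightarrow> u \<alpha> = 0" "\<And>\<alpha>. mdeg \<alpha> < b \<Longrightarrow> v \<alpha> = 0"
  shows "(\<Sum>\<gamma> | mdeg \<gamma> \<le> N. \<Sum>(\<alpha>, \<beta>) | \<alpha> + \<beta> = \<gamma>. u \<alpha> * v \<beta>)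
     \<le> (\<Sum>\<alpha> | mdeg \<alpha> \<le> N - b. u \<alpha>) * (\<Sum>\<beta> | mdeg \<beta> \<le> N - a. v \<beta>)"
proof -
  let ?P = "{(\<alpha>, \<beta>). mdeg (\<alpha> + \<beta> :: nat ^ 'n) \<le> N}"
  let ?Q = "{\<alpha>. mdeg (\<alpha> :: nat ^ 'n) \<le> N - b} \<times> {\<beta>. mdeg (\<beta> :: nat ^ 'n) \<le> N - a}"
  let ?t = "\<lambda>(\<alpha>, \<beta>). u \<alpha> * v \<beta>"
  have fin: "finite ?P"
    by (rule finite_subset[of _ "{\<alpha>. mdeg \<alpha> \<le> N} \<times> {\<beta>. mdeg \<beta> \<le> N}"]) (auto simp: mdeg_add)
  have "(\<Sum>\<gamma> | mdeg \<gamma> \<le> N. \<Sum>(\<alpha>, \<beta>) | \<alpha> + \<beta> = \<gamma>. u \<alpha> * v \<beta>) =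
      (\<Sum>\<gamma> | mdeg \<gamma> \<le> N. sum ?t {x \<in> ?P. (\<lambda>(\<alpha>, \<beta>). \<alpha> + \<beta>) x = \<gamma>})"
    by (intro sum.cong) auto
  also have "\<dots> = sum ?t ?P"
    by (rule sum.group) (use fin in auto)
  also have "\<dots> = sum ?t (?P \<inter> ?Q)"
  proof (rule sum.mono_neutral_right[OF fin])
    show "\<forall>x\<in>?P - ?P \<inter> ?Q. ?t x = 0"
    proof
      fix x assume "x \<in> ?P - ?P \<inter> ?Q"
      then obtain \<alpha> \<beta> where x: "x = (\<alpha>, \<beta>)" and "mdeg \<alpha> + mdeg \<beta> \<le> N"
          and "\<not> mdeg \<alpha> \<le> N - b \<or> \<not> mdeg \<beta> \<le> N - a"
        by (auto simp: mdeg_add)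
      then have "mdeg \<alpha> < a \<or> mdeg \<beta> < b" by arith
      then show "?t x = 0" using order x by auto
    qed
  qed auto
  also have "\<dots> \<le> sum ?t ?Q"
    by (rule sum_mono2) (auto simp: nonneg intro!: finite_cartesian_product)
  also have "\<dots> = (\<Sum>\<alpha> | mdeg \<alpha> \<le> N - b. u \<alpha>) * (\<Sum>\<beta> | mdeg \<beta> \<le> N - a. v \<beta>)"
    by (simp add: sum_product sum.cartesian_product)
  finally show ?thesis .
qed

lemma mfps_const_1: "mfps_const 1 = 1"
  by (simp add: mfps_const_def one_mfps_def)

lemma mfps_const_0: "mfps_const 0 = 0"
  by (simp add: mfps_const_def zero_mfps_def)

lemma mdeg_0 [simp]: "mdeg 0 = 0"
  by (simp add: mdeg_def)

text \<open>The weighted l1 norm of a Taylor polynomial. Truncation keeps it finite before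
  convergence is known; a bound uniform in N then yields convergence.\<close>

definition pnorm :: "real \<Rightarrow> nat \<Rightarrow> (complex, 'n::finite) mfps \<Rightarrow> real" where
  "pnorm \<rho> N f = (\<Sum>\<alpha> | mdeg \<alpha> \<le> N. norm (mfps_nth f \<alpha>) * \<rho> ^ mdeg \<alpha>)"

lemma pnorm_mono_radius: "0 \<le> \<rho> \<Longrightarrow> \<rho> \<le> \<sigma> \<Longrightarrow> pnorm \<rho> N f \<le> pnorm \<sigma> N f"
  unfolding pnorm_def by (intro sum_mono mult_left_mono power_mono) auto

lemma pnorm_nonneg: "0 \<le> \<rho> \<Longrightarrow> 0 \<le> pnorm \<rho> N f"
  unfolding pnorm_def by (intro sum_nonneg) auto

lemma pnorm_0: "starts_at 1 f \<Longrightarrow> pnorm \<rho> 0 f = 0"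
  by (simp add: pnorm_def starts_at_def)

lemma pnorm_uminus [simp]: "pnorm \<rho> N (- f) = pnorm \<rho> N f"
  by (simp add: pnorm_def)

lemma pnorm_add: "0 \<le> \<rho> \<Longrightarrow> pnorm \<rho> N (f + g) \<le> pnorm \<rho> N f + pnorm \<rho> N g"
  unfolding pnorm_def sum.distrib[symmetric] distrib_right[symmetric]
  by (intro sum_mono mult_right_mono) (auto intro: norm_triangle_ineq)

lemma pnorm_monom: "0 \<le> \<rho> \<Longrightarrow> pnorm \<rho> N (mfps_const c * mfps_monom \<alpha>) \<le> norm c * \<rho> ^ mdeg \<alpha>"
proof -
  assume "0 \<le> \<rho>"
  have "pnorm \<rho> N (mfps_const c * mfps_monom \<alpha>) =
      (\<Sum>\<beta> | mdeg \<beta> \<le> N. if \<beta> = \<alpha> then norm c * \<rho> ^ mdeg \<alpha> else 0)"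
    unfolding pnorm_def by (rule sum.cong) (auto simp: mfps_nth_monom)
  with \<open>0 \<le> \<rho>\<close> show ?thesis by simp
qed

lemma pnorm_X: "0 \<le> \<rho> \<Longrightarrow> pnorm \<rho> N (mfps_X i) \<le> \<rho>"
  using pnorm_monom[of \<rho> N 1 "axis i 1"] by (simp add: pnorm_def mfps_monom_axis)

lemma pnorm_const: "0 \<le> \<rho> \<Longrightarrow> pnorm \<rho> N (mfps_const c) \<le> norm c"
  using pnorm_monom[of \<rho> N c 0] by simp

lemma pnorm_mult:
  fixes f g :: "(complex, 'n::finite) mfps"
  assumes "0 \<le> \<rho>" "starts_at a f" "starts_at b g"
  shows "pnorm \<rho> N (f * g) \<le> pnorm \<rho> (N - b) f * pnorm \<rho> (N - a) g"
proof -
  have "pnorm \<rho> N (f * g) \<le> (\<Sum>\<gamma> | mdeg \<gamma> \<le> N. \<Sum>(\<alpha>, \<beta>) | \<alpha> + \<beta> = \<gamma>.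
      (norm (mfps_nth f \<alpha>) * \<rho> ^ mdeg \<alpha>) * (norm (mfps_nth g \<beta>) * \<rho> ^ mdeg \<beta>))"
    unfolding pnorm_def
  proof (rule sum_mono)
    fix \<gamma> :: "nat ^ 'n"
    have "norm (mfps_nth (f * g) \<gamma>) * \<rho> ^ mdeg \<gamma>
        \<le> (\<Sum>(\<alpha>, \<beta>) | \<alpha> + \<beta> = \<gamma>. norm (mfps_nth f \<alpha>) * norm (mfps_nth g \<beta>)) * \<rho> ^ mdeg \<gamma>"
      using assms(1) unfolding mfps_nth_mult
      by (intro mult_right_mono order_trans[OF norm_sum] sum_mono) (auto simp: norm_mult)
    also have "\<dots> = (\<Sum>(\<alpha>, \<beta>) | \<alpha> + \<beta> = \<gamma>.
      (norm (mfps_nth f \<alpha>) * \<rho> ^ mdeg \<alpha>) * (norm (mfps_nth g \<beta>) * \<rho> ^ mdeg \<beta>))"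
      unfolding sum_distrib_right by (rule sum.cong) (auto simp: mdeg_add power_add)
    finally show "norm (mfps_nth (f * g) \<gamma>) * \<rho> ^ mdeg \<gamma> \<le> (\<Sum>(\<alpha>, \<beta>) | \<alpha> + \<beta> = \<gamma>.
      (norm (mfps_nth f \<alpha>) * \<rho> ^ mdeg \<alpha>) * (norm (mfps_nth g \<beta>) * \<rho> ^ mdeg \<beta>))" .
  qed
  also have "\<dots> \<le> pnorm \<rho> (N - b) f * pnorm \<rho> (N - a) g"
    unfolding pnorm_def using assms
    by (intro sum_convolution_le) (auto simp: starts_at_def)
  finally show ?thesis .
qed

text \<open>Division by a variable costs one degree and one factor \<rho>. The homological equation
  controls \<open>mfps_X k * E $ k\<close>, and this recovers \<open>E $ k\<close> from it.\<close>

lemma pnorm_X_mult: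
  assumes "0 \<le> \<rho>"
  shows "\<rho> * pnorm \<rho> N f \<le> pnorm \<rho> (Suc N) (mfps_X i * f)"
proof -
  let ?s = "\<lambda>\<beta> :: nat ^ 'a. axis i (Suc 0) + \<beta>"
  have "\<rho> * pnorm \<rho> N f = (\<Sum>\<beta> | mdeg \<beta> \<le> N. norm (mfps_nth (mfps_X i * f) (?s \<beta>)) * \<rho> ^ mdeg (?s \<beta>))"
    unfolding pnorm_def sum_distrib_left mfps_monom_axis[symmetric] mfps_nth_monom_mult mdeg_add
    by (simp add: mult_ac)
  also have "\<dots> = (\<Sum>\<gamma> \<in> ?s ` {\<beta>. mdeg \<beta> \<le> N}. norm (mfps_nth (mfps_X i * f) \<gamma>) * \<rho> ^ mdeg \<gamma>)"
    by (subst sum.reindex) (auto simp: inj_on_def)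
  also have "\<dots> \<le> pnorm \<rho> (Suc N) (mfps_X i * f)"
    unfolding pnorm_def using assms by (intro sum_mono2) (auto simp: mdeg_add)
  finally show ?thesis .
qed

context
  fixes z :: "(complex, 'n::finite) mfps ^ 'm::finite" and \<rho> B :: real and N :: nat
  assumes z: "\<And>i. starts_at 1 (z $ i)" and \<rho>: "0 \<le> \<rho>" and zB: "\<And>i. pnorm \<rho> N (z $ i) \<le> B"
begin

lemma pnorm_mpow: "pnorm \<rho> N (mpow z \<alpha>) \<le> B ^ mdeg \<alpha>"
proof (induction \<alpha> rule: multi_index_induct)
  case zero
  then show ?case using pnorm_const[OF \<rho>, of N 1] by (simp add: mfps_const_1)
next
  case (add \<alpha> i)
  have "pnorm \<rho> N (mpow z \<alpha> * z $ i) \<le> pnorm \<rho> N (mpow z \<alpha>) * pnorm \<rho> N (z $ i)"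
    using pnorm_mult[OF \<rho>, of 0 _ 0] by simp
  also have "\<dots> \<le> B ^ mdeg \<alpha> * B"
    using add zB[of i] pnorm_nonneg[OF \<rho>] by (intro mult_mono) (auto intro: order_trans)
  finally show ?case
    using mpow_add[of z \<alpha> "axis i 1"] mpow_axis[of z i] by (simp add: mdeg_add mult.commute[of B])
qed

text \<open>A product of two factors without constant term needs the factors only up to one degree less;
  this gain is what allows bounds on truncations to be propagated from degree \<open>N\<close> to \<open>N + 1\<close>.\<close>

lemma pnorm_mpow_Suc:
  assumes "mdeg \<alpha> \<ge> 2"
  shows "pnorm \<rho> (Suc N) (mpow z \<alpha>) \<le> B ^ mdeg \<alpha>"
  using assms
proof (induction \<alpha> rule: multi_index_induct)
  case (add \<alpha> i)
  have "starts_at 1 (mpow z \<alpha>)"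
    using add.prems starts_at_monomial[OF z, of \<alpha>] by (auto simp: mdeg_add intro: starts_at_mono)
  then have "pnorm \<rho> (Suc N) (mpow z \<alpha> * z $ i) \<le> pnorm \<rho> N (mpow z \<alpha>) * pnorm \<rho> N (z $ i)"
    using pnorm_mult[OF \<rho> _ z, of 1 "mpow z \<alpha>" "Suc N" i] by simp
  also have "\<dots> \<le> B ^ mdeg \<alpha> * B"
    using pnorm_mpow zB[of i] pnorm_nonneg[OF \<rho>] by (intro mult_mono) (auto intro: order_trans)
  finally show ?case
    using mpow_add[of z \<alpha> "axis i 1"] mpow_axis[of z i] by (simp add: mdeg_add mult.commute[of B])
qed simp

text \<open>Although \<open>z\<close> is controlled only through degree N, the composite is
  controlled through N + 1, because \<open>f\<close> has no linear part. The bound on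
  \<open>z\<close> becomes the radius at which \<open>f\<close> is measured.\<close>

lemma pnorm_compose:
  assumes "starts_at 2 f"
  shows "pnorm \<rho> (Suc N) (mfps_compose f z) \<le> pnorm B (Suc N) f"
proof -
  have "pnorm \<rho> (Suc N) (mfps_compose f z) \<le>
      (\<Sum>\<gamma> | mdeg \<gamma> \<le> Suc N. (\<Sum>\<alpha> | mdeg \<alpha> \<le> Suc N.
        norm (mfps_nth f \<alpha>) * norm (mfps_nth (mpow z \<alpha>) \<gamma>)) * \<rho> ^ mdeg \<gamma>)"
    unfolding pnorm_def
  proof (intro sum_mono mult_right_mono)
    fix \<gamma> :: "nat ^ 'n" assume "\<gamma> \<in> {\<gamma>. mdeg \<gamma> \<le> Suc N}"
    then have "mdeg \<gamma> \<le> Suc N" by simp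
    then show "norm (mfps_nth (mfps_compose f z) \<gamma>) \<le>
        (\<Sum>\<alpha> | mdeg \<alpha> \<le> Suc N. norm (mfps_nth f \<alpha>) * norm (mfps_nth (mpow z \<alpha>) \<gamma>))"
      unfolding mfps_compose_nth[OF z \<open>mdeg \<gamma> \<le> Suc N\<close>]
      by (intro order_trans[OF norm_sum] sum_mono) (simp add: norm_mult)
  qed (use \<rho> in auto)
  also have "\<dots> = (\<Sum>\<alpha> | mdeg \<alpha> \<le> Suc N. norm (mfps_nth f \<alpha>) * pnorm \<rho> (Suc N) (mpow z \<alpha>))"
    unfolding pnorm_def sum_distrib_left sum_distrib_right
    by (subst sum.swap) (simp only: mult.assoc)
  also have "\<dots> \<le> pnorm B (Suc N) f"
    unfolding pnorm_def[of B]
  proof (intro sum_mono)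
    fix \<alpha> :: "nat ^ 'm"
    show "norm (mfps_nth f \<alpha>) * pnorm \<rho> (Suc N) (mpow z \<alpha>) \<le> norm (mfps_nth f \<alpha>) * B ^ mdeg \<alpha>"
    proof (cases "mdeg \<alpha> \<ge> 2")
      case True
      then show ?thesis by (intro mult_left_mono pnorm_mpow_Suc) auto
    qed (use assms in \<open>auto simp: starts_at_def\<close>)
  qed
  finally show ?thesis .
qed

end

subsection \<open>Series with bounded majorant norms\<close>

text \<open>Convergence is carried in this form because the norms are subadditive and
  submultiplicative, so closure under ring operations and substitution is a matter of estimates at
  one radius.\<close>

definition majorized :: "(complex, 'n::finite) mfps \<Rightarrow> bool" where
  "majorized f \<longleftrightarrow> (\<exists>\<rho>>0. \<exists>C. \<forall>N. pnorm \<rho> N f \<le> C)"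

lemma majorizedI: "0 < \<rho> \<Longrightarrow> (\<And>N. pnorm \<rho> N f \<le> C) \<Longrightarrow> majorized f"
  unfolding majorized_def by blast

lemma majorized_imp_convergent:
  assumes "majorized f"
  shows "mfps_convergent f"
proof -
  obtain \<rho> C where \<rho>: "\<rho> > 0" and C: "\<And>N. pnorm \<rho> N f \<le> C"
    using assms by (auto simp: majorized_def)
  let ?t = "\<lambda>\<alpha>. norm (mfps_nth f \<alpha>) * \<rho> ^ mdeg \<alpha>"
  have t: "?t summable_on UNIV"
  proof (rule nonneg_bdd_above_summable_on)
    show "bdd_above (sum ?t ` {F. F \<subseteq> UNIV \<and> finite F})"
    proof (rule bdd_aboveI2)
      fix I :: "(nat ^ 'a) set" assume "I \<in> {F. F \<subseteq> UNIV \<and> finite F}"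
      then have "finite I" by simp
      \<comment> \<open>A crude common bound for the degrees of the finitely many indices.\<close>
      define N where "N = (\<Sum>\<alpha>\<in>I. mdeg \<alpha>)"
      have "mdeg \<alpha> \<le> N" if "\<alpha> \<in> I" for \<alpha>
        unfolding N_def by (rule member_le_sum) (use that \<open>finite I\<close> in auto)
      then have "sum ?t I \<le> pnorm \<rho> N f"
        unfolding pnorm_def using \<rho> by (intro sum_mono2) auto
      then show "sum ?t I \<le> C" using C order_trans by blast
    qed
  qed (use \<rho> in auto)
  have "(\<lambda>\<alpha>. mfps_nth f \<alpha> * (\<Prod>i\<in>UNIV. (x $ i) ^ (\<alpha> $ i))) summable_on UNIV"
    if x: "norm x < \<rho>" for x :: "complex ^ 'a"
  proof (rule abs_summable_summable, rule summable_on_comparison_test[OF t])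
    fix \<alpha> :: "nat ^ 'a"
    have "norm (\<Prod>i\<in>UNIV. (x $ i) ^ (\<alpha> $ i)) \<le> (\<Prod>i\<in>UNIV. \<rho> ^ (\<alpha> $ i))"
      unfolding prod_norm[symmetric] norm_power
      using x Finite_Cartesian_Product.norm_nth_le[of x]
      by (intro prod_mono conjI power_mono) (auto intro: order_trans less_imp_le)
    then have "norm (\<Prod>i\<in>UNIV. (x $ i) ^ (\<alpha> $ i)) \<le> \<rho> ^ mdeg \<alpha>"
      by (simp add: mdeg_def power_sum)
    then show "norm (mfps_nth f \<alpha> * (\<Prod>i\<in>UNIV. (x $ i) ^ (\<alpha> $ i))) \<le> ?t \<alpha>"
      unfolding norm_mult by (intro mult_left_mono) auto
  qed auto
  with \<rho> show ?thesis unfolding mfps_convergent_def by blast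
qed

lemma majorized_const: "majorized (mfps_const c)"
  by (rule majorizedI[of 1]) (auto intro: pnorm_const)

lemma majorized_X: "majorized (mfps_X i)"
  by (rule majorizedI[of 1]) (auto intro: pnorm_X)

lemma majorized_common_radius:
  assumes "majorized f" "majorized g"
  obtains \<rho> C D where "0 < \<rho>" "\<And>N. pnorm \<rho> N f \<le> C" "\<And>N. pnorm \<rho> N g \<le> D"
proof -
  obtain \<rho> C \<sigma> D where *: "0 < \<rho>" "0 < \<sigma>" "\<And>N. pnorm \<rho> N f \<le> C" "\<And>N. pnorm \<sigma> N g \<le> D"
    using assms by (auto simp: majorized_def)
  show thesis
  proof (rule that[of "min \<rho> \<sigma>" C D])
    show "pnorm (min \<rho> \<sigma>) N f \<le> C" "pnorm (min \<rho> \<sigma>) N g \<le> D" for N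
      using * pnorm_mono_radius[of "min \<rho> \<sigma>" \<rho> N f] pnorm_mono_radius[of "min \<rho> \<sigma>" \<sigma> N g]
      by (auto intro: order_trans)
  qed (use * in auto)
qed

lemma majorized_add: "majorized f \<Longrightarrow> majorized g \<Longrightarrow> majorized (f + g)"
  by (erule (1) majorized_common_radius, rule majorizedI, assumption)
     (auto intro!: order_trans[OF pnorm_add] add_mono)

lemma majorized_mult:
  assumes "majorized f" "majorized g"
  shows "majorized (f * g)"
proof -
  obtain \<rho> C D where *: "0 < \<rho>" "\<And>N. pnorm \<rho> N f \<le> C" "\<And>N. pnorm \<rho> N g \<le> D"
    using majorized_common_radius[OF assms] by blast
  have C: "0 \<le> C" using *(2)[of 0] pnorm_nonneg[of \<rho> 0 f] *(1) by linarith
  have "pnorm \<rho> N (f * g) \<le> C * D" for N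
  proof -
    have "pnorm \<rho> N (f * g) \<le> pnorm \<rho> N f * pnorm \<rho> N g"
      using pnorm_mult[of \<rho> 0 f 0 g N] *(1) by simp
    also have "\<dots> \<le> C * D"
      using * C pnorm_nonneg[of \<rho>] by (intro mult_mono) auto
    finally show ?thesis .
  qed
  then show ?thesis using *(1) by (rule majorizedI[rotated])
qed

lemma majorized_power: "majorized f \<Longrightarrow> majorized (f ^ k)"
  using majorized_const[of 1]
  by (induction k) (auto intro: majorized_mult simp: mfps_const_1)

lemma majorized_sum: "(\<And>i. i \<in> I \<Longrightarrow> majorized (f i)) \<Longrightarrow> majorized (\<Sum>i\<in>I. f i)"
  using majorized_const[of 0]
  by (induction I rule: infinite_finite_induct)
     (auto intro: majorized_add simp: mfps_const_0)

text \<open>Shrinking the radius multiplies a monomial of degree at least d by at most the d-th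
  power of the ratio, as in the Schwarz lemma.\<close>

lemma pnorm_rescale:
  assumes "starts_at d f" "0 \<le> r" "r \<le> \<sigma>" "0 < \<sigma>"
  shows "pnorm r N f \<le> pnorm \<sigma> N f * (r / \<sigma>) ^ d"
  unfolding pnorm_def sum_distrib_right
proof (rule sum_mono)
  fix \<alpha> :: "nat ^ 'a"
  show "norm (mfps_nth f \<alpha>) * r ^ mdeg \<alpha> \<le> norm (mfps_nth f \<alpha>) * \<sigma> ^ mdeg \<alpha> * (r / \<sigma>) ^ d"
  proof (cases "mdeg \<alpha> < d")
    case False
    have "r ^ mdeg \<alpha> = \<sigma> ^ mdeg \<alpha> * (r / \<sigma>) ^ mdeg \<alpha>"
      using assms by (simp add: power_divide)
    also have "\<dots> \<le> \<sigma> ^ mdeg \<alpha> * (r / \<sigma>) ^ d"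
      using False assms by (intro mult_left_mono power_decreasing) auto
    finally show ?thesis by (simp add: mult.assoc mult_left_mono)
  qed (use assms in \<open>simp add: starts_at_def\<close>)
qed

text \<open>With order two the norm decays like the square of the radius, and so can be made smaller
  than any fixed multiple of the radius. Finitely many components share a radius and a
  constant.\<close>

lemma majorized_quadratic_bound:
  fixes f :: "(complex, 'n::finite) mfps ^ 'm::finite"
  assumes "\<And>k. majorized (f $ k)" "\<And>k. starts_at 2 (f $ k)"
  obtains \<sigma> K where "0 < \<sigma>" "0 \<le> K" "\<And>k r N. 0 \<le> r \<Longrightarrow> r \<le> \<sigma> \<Longrightarrow> pnorm r N (f $ k) \<le> K * r\<^sup>2"
proof -
  have "\<forall>k. \<exists>\<rho> C. 0 < \<rho> \<and> (\<forall>N. pnorm \<rho> N (f $ k) \<le> C)"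
    using assms(1) by (auto simp: majorized_def)
  then obtain s C where s: "\<And>k. 0 < s k" and C: "\<And>k N. pnorm (s k) N (f $ k) \<le> C k"
    by metis
  have C0: "0 \<le> C k" for k using C[of k 0] pnorm_nonneg[of "s k"] s[of k] by (meson less_imp_le order_trans)
  show thesis
  proof (rule that[of "Min (range s)" "\<Sum>k\<in>UNIV. C k / (s k)\<^sup>2"])
    show "0 < Min (range s)" using s by simp
    show "0 \<le> (\<Sum>k\<in>UNIV. C k / (s k)\<^sup>2)" using C0 by (intro sum_nonneg) auto
    fix k r N assume r: "0 \<le> r" "r \<le> Min (range s)"
    have "r \<le> s k" using r(2) by simp
    then have "pnorm r N (f $ k) \<le> pnorm (s k) N (f $ k) * (r / s k)\<^sup>2"
      using assms(2) s r(1) by (intro pnorm_rescale) auto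
    also have "\<dots> \<le> C k * (r / s k)\<^sup>2"
      by (intro mult_right_mono C) auto
    also have "\<dots> = C k / (s k)\<^sup>2 * r\<^sup>2" by (simp add: power_divide)
    also have "\<dots> \<le> (\<Sum>k\<in>UNIV. C k / (s k)\<^sup>2) * r\<^sup>2"
      using C0 by (intro mult_right_mono member_le_sum) auto
    finally show "pnorm r N (f $ k) \<le> (\<Sum>k\<in>UNIV. C k / (s k)\<^sup>2) * r\<^sup>2" .
  qed
qed

text \<open>Propagation in the truncation degree: if the inverse correction is at most r/2 at radius
  r/2, the substituted variables are at most r, where \<open>h\<close> is at most r/2. The fixed
  point equation then returns the same bound one degree higher.\<close>

lemma majorized_inverse:
  assumes h: "\<And>k. starts_at 2 (h $ k)" "\<And>k. majorized (h $ k)"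
    and g: "\<And>k. starts_at 2 (g $ k)"
      "\<And>k. g $ k = - mfps_compose (h $ k) (\<chi> i. mfps_X i + g $ i)"
  shows "majorized (g $ k)"
proof -
  obtain \<sigma> K where \<sigma>: "0 < \<sigma>" and K: "0 \<le> K"
    and bound: "\<And>k r N. 0 \<le> r \<Longrightarrow> r \<le> \<sigma> \<Longrightarrow> pnorm r N (h $ k) \<le> K * r\<^sup>2"
    using majorized_quadratic_bound[OF h(2,1)] by blast
  \<comment> \<open>The second entry gives K r \<le> 1/2, hence a quadratic bound of at most
    r/2.\<close>
  define r where "r = min \<sigma> (1 / (2 * (K + 1)))"
  have r: "0 < r" "r \<le> \<sigma>" using \<sigma> K by (auto simp: r_def)
  have "K * r \<le> 1 / 2"
  proof -
    have "K * r \<le> (K + 1) * (1 / (2 * (K + 1)))"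
      using K r(1) by (intro mult_mono) (auto simp: r_def)
    also have "\<dots> = 1 / 2" using K by (simp add: field_simps)
    finally show ?thesis .
  qed
  then have *: "K * r * r \<le> 1 / 2 * r" using r(1) by (intro mult_right_mono) auto
  have hr: "pnorm r N (h $ k) \<le> r / 2" for k N
    using bound[of r N k] r * unfolding power2_eq_square by linarith
  have "pnorm (r / 2) N (g $ k) \<le> r / 2" for N k
  proof (induction N arbitrary: k)
    case 0
    then show ?case using r(1) pnorm_0[OF starts_at_mono[OF g(1)]] by simp
  next
    case (Suc N)
    have "pnorm (r / 2) (Suc N) (mfps_compose (h $ k) (\<chi> i. mfps_X i + g $ i)) \<le> pnorm r (Suc N) (h $ k)"
    proof (rule pnorm_compose)
      fix i
      show "starts_at 1 ((\<chi> i. mfps_X i + g $ i) $ i)" by (simp only: vec_lambda_beta starts_at_X_add g(1))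
      have "pnorm (r / 2) N (mfps_X i + g $ i) \<le> pnorm (r / 2) N (mfps_X i) + pnorm (r / 2) N (g $ i)"
        using r(1) by (intro pnorm_add) simp
      also have "\<dots> \<le> r / 2 + r / 2" using r(1) Suc by (intro add_mono pnorm_X) auto
      finally show "pnorm (r / 2) N ((\<chi> i. mfps_X i + g $ i) $ i) \<le> r" by simp
    qed (use r h in auto)
    also have "\<dots> \<le> r / 2" by (rule hr)
    finally show ?case unfolding g(2)[of k] pnorm_uminus .
  qed
  then show ?thesis using r(1) by (intro majorizedI[of "r / 2" _ "r / 2"]) auto
qed

text \<open>\<open>h\<close> is the normalizing transformation, \<open>mfps_X k * E $ k\<close> the nonlinear part of the normal form
  and \<open>R\<close> that of the original system.\<close>

lemma majorized_normalization:
  fixes h E R :: "(complex, 'n::finite) mfps ^ 'n"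
  assumes h: "\<And>k. starts_at 2 (h $ k)" and E: "\<And>k. starts_at 1 (E $ k)"
    and R: "\<And>k. starts_at 2 (R $ k)" "\<And>k. majorized (R $ k)" and C: "0 \<le> C"
    and majorant: "\<And>k \<alpha>. max (norm (mfps_nth (h $ k) \<alpha>)) (norm (mfps_nth (mfps_X k * E $ k) \<alpha>)) \<le>
      norm (mfps_nth (mfps_compose (R $ k) (\<chi> i. mfps_X i + h $ i)) \<alpha>) +
      C * (\<Sum>(\<beta>, \<gamma>) | \<beta> + \<gamma> = \<alpha>. (\<Sum>j\<in>UNIV. norm (mfps_nth (E $ j) \<beta>)) * norm (mfps_nth (h $ k) \<gamma>))"
  shows "majorized (h $ k)" "majorized (E $ k)"
proof -
  obtain \<sigma> K where \<sigma>: "0 < \<sigma>" and K: "0 \<le> K"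
    and bound: "\<And>k r N. 0 \<le> r \<Longrightarrow> r \<le> \<sigma> \<Longrightarrow> pnorm r N (R $ k) \<le> K * r\<^sup>2"
    using majorized_quadratic_bound[OF R(2,1)] by blast
  define c where "c = C * real CARD('n)"
  have c: "0 \<le> c" using C by (simp add: c_def)
  \<comment> \<open>With c \<epsilon> \<le> 1/2 the product term takes up at most half of the target
    \<rho> \<epsilon>.\<close>
  define \<epsilon> where "\<epsilon> = 1 / (2 * (c + 1))"
  have \<epsilon>: "0 < \<epsilon>" "\<epsilon> \<le> 1" "c * \<epsilon> \<le> 1 / 2" using c by (auto simp: \<epsilon>_def field_simps)
  \<comment> \<open>\<open>R\<close> is evaluated at radius 2 \<rho>, which must stay below
    \<sigma>; the factor 8 makes its contribution, four times K \<rho> squared, at most the other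
    half of \<rho> \<epsilon>.\<close>
  define \<rho> where "\<rho> = min (\<sigma> / 2) (\<epsilon> / (8 * (K + 1)))"
  have \<rho>: "0 < \<rho>" "2 * \<rho> \<le> \<sigma>" using \<sigma> \<epsilon> K by (auto simp: \<rho>_def)
  have "K * \<rho> \<le> (K + 1) * (\<epsilon> / (8 * (K + 1)))"
    using K \<rho>(1) by (intro mult_mono) (auto simp: \<rho>_def)
  also have "\<dots> = \<epsilon> / 8" using K by (simp add: field_simps)
  finally have K\<rho>: "4 * (K * \<rho>) \<le> \<epsilon> / 2" by simp
  let ?z = "\<chi> i. mfps_X i + h $ i"
  have bounds: "\<forall>k. pnorm \<rho> N (h $ k) \<le> \<rho> * \<epsilon> \<and> pnorm \<rho> N (mfps_X k * E $ k) \<le> \<rho> * \<epsilon>" for N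
  proof (induction N)
    case 0
    have "starts_at 1 (h $ k)" "starts_at 1 (mfps_X k * E $ k)" for k
      using starts_at_mono[OF h] starts_at_mult_right[OF E] by auto
    then show ?case using \<rho> \<epsilon> by (simp add: pnorm_0)
  next
    case (Suc N)
    note IH = spec[OF Suc]
    \<comment> \<open>A bound \<rho> \<epsilon> on \<open>mfps_X j * E $ j\<close> through degree N
      gives \<epsilon> on \<open>E $ j\<close> through degree N - 1. For N = 0 the truncated
      subtraction leaves degree zero, where \<open>E $ j\<close> vanishes.\<close>
    have EN: "pnorm \<rho> (N - 1) (E $ j) \<le> \<epsilon>" for j
    proof (cases N)
      case 0
      then show ?thesis using \<epsilon> pnorm_0[OF E] by simp
    next
      case (Suc M)
      then have "\<rho> * pnorm \<rho> M (E $ j) \<le> \<rho> * \<epsilon>"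
        using IH[of j, unfolded Suc] pnorm_X_mult[of \<rho> M "E $ j" j] \<rho>(1) by linarith
      then show ?thesis using \<rho>(1) Suc by simp
    qed
    have "(\<Sum>\<alpha> | mdeg \<alpha> \<le> Suc N. (norm (mfps_nth (mfps_compose (R $ k) ?z) \<alpha>) +
        C * (\<Sum>(\<beta>, \<gamma>) | \<beta> + \<gamma> = \<alpha>. (\<Sum>j\<in>UNIV. norm (mfps_nth (E $ j) \<beta>)) * norm (mfps_nth (h $ k) \<gamma>)))
        * \<rho> ^ mdeg \<alpha>) \<le> \<rho> * \<epsilon>" (is "?T \<le> _") for k
    proof -
      let ?u = "\<lambda>\<beta>. (\<Sum>j\<in>UNIV. norm (mfps_nth (E $ j) \<beta>)) * \<rho> ^ mdeg \<beta>"
      let ?v = "\<lambda>\<gamma>. norm (mfps_nth (h $ k) \<gamma>) * \<rho> ^ mdeg \<gamma>"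
      have conv: "(\<Sum>(\<beta>, \<gamma>) | \<beta> + \<gamma> = \<alpha>. (\<Sum>j\<in>UNIV. norm (mfps_nth (E $ j) \<beta>)) * norm (mfps_nth (h $ k) \<gamma>))
          * \<rho> ^ mdeg \<alpha> = (\<Sum>(\<beta>, \<gamma>) | \<beta> + \<gamma> = \<alpha>. ?u \<beta> * ?v \<gamma>)" for \<alpha>
        unfolding sum_distrib_right[of _ _ "\<rho> ^ mdeg \<alpha>"]
        by (rule sum.cong) (auto simp: mdeg_add power_add)
      have "?T = pnorm \<rho> (Suc N) (mfps_compose (R $ k) ?z) +
          C * (\<Sum>\<alpha> | mdeg \<alpha> \<le> Suc N. \<Sum>(\<beta>, \<gamma>) | \<beta> + \<gamma> = \<alpha>. ?u \<beta> * ?v \<gamma>)"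
        unfolding pnorm_def conv[symmetric] sum_distrib_left[where r = C and A = "{\<alpha>. mdeg \<alpha> \<le> Suc N}"]
        by (simp only: distrib_right sum.distrib mult.assoc)
      also have "pnorm \<rho> (Suc N) (mfps_compose (R $ k) ?z) \<le> pnorm (2 * \<rho>) (Suc N) (R $ k)"
      proof (rule pnorm_compose)
        fix i
        show "starts_at 1 (?z $ i)" by (simp only: vec_lambda_beta starts_at_X_add h)
        have "pnorm \<rho> N (mfps_X i + h $ i) \<le> pnorm \<rho> N (mfps_X i) + pnorm \<rho> N (h $ i)"
          using \<rho>(1) by (intro pnorm_add) simp
        also have "\<dots> \<le> \<rho> + \<rho> * \<epsilon>" using \<rho>(1) Suc by (intro add_mono pnorm_X) auto
        also have "\<dots> \<le> \<rho> + \<rho> * 1" using \<rho>(1) \<epsilon>(2) by (intro add_left_mono mult_left_mono) auto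
        finally show "pnorm \<rho> N (?z $ i) \<le> 2 * \<rho>" by simp
      qed (use \<rho> R in auto)
      also have "\<dots> \<le> K * (2 * \<rho>)\<^sup>2" using \<rho> by (intro bound) auto
      also have "\<dots> = \<rho> * (4 * (K * \<rho>))" by (simp add: power2_eq_square)
      also have "\<dots> \<le> \<rho> * (\<epsilon> / 2)" using \<rho>(1) K\<rho> by (intro mult_left_mono) auto
      \<comment> \<open>The orders one of \<open>E\<close> and two of \<open>h\<close> cut the
        ranges down to degrees N and N - 1, all covered by the induction hypothesis.\<close>
      also have "(\<Sum>\<alpha> | mdeg \<alpha> \<le> Suc N. \<Sum>(\<beta>, \<gamma>) | \<beta> + \<gamma> = \<alpha>. ?u \<beta> * ?v \<gamma>)
          \<le> sum ?u {\<beta>. mdeg \<beta> \<le> Suc N - 2} * sum ?v {\<gamma>. mdeg \<gamma> \<le> Suc N - 1}"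
        using \<rho>(1) E h
        by (intro sum_convolution_le) (auto simp: starts_at_def intro!: sum_nonneg mult_nonneg_nonneg)
      also have "sum ?u {\<beta>. mdeg \<beta> \<le> Suc N - 2} = (\<Sum>j\<in>UNIV. pnorm \<rho> (N - 1) (E $ j))"
        unfolding pnorm_def sum_distrib_right by (subst sum.swap) (simp add: numeral_2_eq_2)
      also have "sum ?v {\<gamma>. mdeg \<gamma> \<le> Suc N - 1} = pnorm \<rho> N (h $ k)"
        by (simp add: pnorm_def)
      also have "(\<Sum>j\<in>UNIV. pnorm \<rho> (N - 1) (E $ j)) * pnorm \<rho> N (h $ k) \<le>
          (\<Sum>j\<in>(UNIV :: 'n set). \<epsilon>) * (\<rho> * \<epsilon>)"
        using EN Suc \<epsilon> \<rho> pnorm_nonneg[of \<rho>]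
        by (intro mult_mono sum_mono) auto
      finally have "?T \<le> \<rho> * (\<epsilon> / 2) + C * ((\<Sum>j\<in>(UNIV :: 'n set). \<epsilon>) * (\<rho> * \<epsilon>))"
        using C by (simp add: add_mono mult_left_mono)
      also have "\<dots> = \<rho> * \<epsilon> * (1 / 2 + c * \<epsilon>)" by (simp add: c_def algebra_simps)
      also have "\<dots> \<le> \<rho> * \<epsilon> * 1" using \<rho>(1) \<epsilon> by (intro mult_left_mono) auto
      finally show ?thesis by simp
    qed
    moreover have "pnorm \<rho> (Suc N) (h $ k) \<le> ?T k" "pnorm \<rho> (Suc N) (mfps_X k * E $ k) \<le> ?T k" for k
      unfolding pnorm_def using \<rho>(1) majorant[of k]
      by (intro sum_mono mult_right_mono; auto)+
    ultimately show ?case by (meson order_trans)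
  qed
  show "majorized (h $ k)" using bounds \<rho>(1) by (intro majorizedI) auto
  show "majorized (E $ k)"
  proof (rule majorizedI[OF \<rho>(1), of _ \<epsilon>])
    fix N
    have "\<rho> * pnorm \<rho> N (E $ k) \<le> \<rho> * \<epsilon>"
      using spec[OF bounds[of "Suc N"], of k] pnorm_X_mult[of \<rho> N "E $ k" k] \<rho>(1) by linarith
    then show "pnorm \<rho> N (E $ k) \<le> \<epsilon>" using \<rho>(1) by simp
  qed
qed

section \<open>The derivation along a resonant normal form\<close>

lemma normal_form_derivation_nth:
  fixes E :: "(complex, 'n::finite) mfps ^ 'n"
  shows "mfps_nth (\<Sum>j\<in>UNIV. (mfps_const (lam $ j) * mfps_X j + mfps_X j * E $ j) * mfps_deriv j f) \<alpha> =
    (\<Sum>j\<in>UNIV. of_nat (\<alpha> $ j) * lam $ j) * mfps_nth f \<alpha> +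
    (\<Sum>(\<beta>, \<gamma>) | \<beta> + \<gamma> = \<alpha>. (\<Sum>j\<in>UNIV. mfps_nth (E $ j) \<beta> * of_nat (\<gamma> $ j)) * mfps_nth f \<gamma>)"
proof -
  have "(mfps_const (lam $ j) * mfps_X j + mfps_X j * E $ j) * mfps_deriv j f =
      mfps_const (lam $ j) * (mfps_X j * mfps_deriv j f) + E $ j * (mfps_X j * mfps_deriv j f)" for j
    by (simp add: algebra_simps)
  then have "mfps_nth (\<Sum>j\<in>UNIV. (mfps_const (lam $ j) * mfps_X j + mfps_X j * E $ j) * mfps_deriv j f) \<alpha> =
      (\<Sum>j\<in>UNIV. lam $ j * (of_nat (\<alpha> $ j) * mfps_nth f \<alpha>)) +
      (\<Sum>j\<in>UNIV. \<Sum>(\<beta>, \<gamma>) | \<beta> + \<gamma> = \<alpha>. mfps_nth (E $ j) \<beta> * (of_nat (\<gamma> $ j) * mfps_nth f \<gamma>))"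
    by (simp add: mfps_nth_sum mfps_nth_X_deriv sum.distrib mfps_nth_mult[of "E $ j" for j])
  also have "(\<Sum>j\<in>UNIV. \<Sum>(\<beta>, \<gamma>) | \<beta> + \<gamma> = \<alpha>. mfps_nth (E $ j) \<beta> * (of_nat (\<gamma> $ j) * mfps_nth f \<gamma>)) =
      (\<Sum>(\<beta>, \<gamma>) | \<beta> + \<gamma> = \<alpha>. (\<Sum>j\<in>UNIV. mfps_nth (E $ j) \<beta> * of_nat (\<gamma> $ j)) * mfps_nth f \<gamma>)"
    by (subst sum.swap) (simp add: sum_distrib_right case_prod_unfold mult.assoc)
  also have "(\<Sum>j\<in>UNIV. lam $ j * (of_nat (\<alpha> $ j) * mfps_nth f \<alpha>)) =
      (\<Sum>j\<in>UNIV. of_nat (\<alpha> $ j) * lam $ j) * mfps_nth f \<alpha>"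
    unfolding sum_distrib_right by (simp add: mult_ac)
  finally show ?thesis .
qed

text \<open>By the chain rule, pullback along the transformation intertwines the derivations of the
  two systems. First integrals can thus be moved between the original system and the normal
  form.\<close>

lemma transforms_to_derivation:
  fixes F N h :: "(complex, 'n::finite) mfps ^ 'n"
  assumes "transforms_to F h N" and h: "\<And>k. starts_at 2 (h $ k)"
  shows "(\<Sum>j\<in>UNIV. N $ j * mfps_deriv j (mfps_compose \<Phi> (\<chi> i. mfps_X i + h $ i))) =
    mfps_compose (\<Sum>k\<in>UNIV. F $ k * mfps_deriv k \<Phi>) (\<chi> i. mfps_X i + h $ i)"
proof -
  let ?z = "\<chi> i. mfps_X i + h $ i"
  have z: "\<And>i. starts_at 1 (?z $ i)" by (simp only: vec_lambda_beta starts_at_X_add h)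
  have "(\<Sum>j\<in>UNIV. N $ j * mfps_deriv j (mfps_compose \<Phi> ?z)) =
      (\<Sum>j\<in>UNIV. \<Sum>k\<in>UNIV. mfps_compose (mfps_deriv k \<Phi>) ?z * (mfps_deriv j (mfps_X k + h $ k) * N $ j))"
    by (simp add: mfps_deriv_compose[OF z] sum_distrib_left mult_ac)
  also have "\<dots> = (\<Sum>k\<in>UNIV. mfps_compose (mfps_deriv k \<Phi>) ?z * mfps_compose (F $ k) ?z)"
    using assms(1) unfolding transforms_to_def by (subst sum.swap) (simp flip: sum_distrib_left)
  also have "\<dots> = mfps_compose (\<Sum>k\<in>UNIV. F $ k * mfps_deriv k \<Phi>) ?z"
    by (simp add: mfps_compose_sum mfps_compose_mult[OF z] mult.commute)
  finally show ?thesis .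
qed

section \<open>The cube roots of unity\<close>

text \<open>The exponents of the powers of w, which are the only ones occurring in Y_k(w).\<close>

definition diag :: "nat \<Rightarrow> nat ^ 3" where
  "diag m = (\<chi> i. m)"

lemma diag_nth [simp]: "diag m $ i = m"
  by (simp add: diag_def)

lemma mfps_X123: "(mfps_X 1 * mfps_X 2 * mfps_X 3 :: ('a::comm_ring_1, 3) mfps) = mfps_monom (diag 1)"
proof -
  have "axis 1 (Suc 0) + axis 2 (Suc 0) + axis 3 (Suc 0) = diag 1"
    by (simp add: vec_eq_iff forall_3 axis_def)
  then show ?thesis by (simp add: mfps_monom_mult flip: mfps_monom_axis)
qed

lemma fps_subst_X123_nth:
  "mfps_nth (fps_subst f (mfps_X 1 * mfps_X 2 * mfps_X 3)) \<gamma> =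
    (if \<gamma> = diag (\<gamma> $ 1) then fps_nth f (\<gamma> $ 1) else (0 :: 'a::comm_ring_1))"
proof -
  have power: "(mfps_monom (diag 1) :: ('a, 3) mfps) ^ k = mfps_monom (diag k)" for k
  proof (induction k)
    case 0
    have "diag 0 = 0" by (simp add: vec_eq_iff)
    then show ?case by simp
  next
    case (Suc k)
    have "diag 1 + diag k = diag (Suc k)" by (simp add: vec_eq_iff)
    then show ?case using Suc by (simp add: mfps_monom_mult)
  qed
  have "mfps_nth (fps_subst f (mfps_X 1 * mfps_X 2 * mfps_X 3)) \<gamma> =
      (\<Sum>k\<le>mdeg \<gamma>. if \<gamma> = diag k then fps_nth f k else 0)"
    unfolding fps_subst_def mfps_X123 power by (auto simp: mfps_nth_monom intro!: sum.cong)
  also have "\<dots> = (\<Sum>k\<le>mdeg \<gamma>. if k = \<gamma> $ 1 then (if \<gamma> = diag (\<gamma> $ 1) then fps_nth f (\<gamma> $ 1) else 0) else 0)"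
    by (rule sum.cong) (auto simp del: diag_nth, auto)
  also have "\<dots> = (if \<gamma> = diag (\<gamma> $ 1) then fps_nth f (\<gamma> $ 1) else 0)"
  proof -
    have "\<gamma> $ 1 \<le> mdeg \<gamma>" by (simp add: mdeg_def sum_3)
    then show ?thesis by simp
  qed
  finally show ?thesis .
qed

text \<open>If a sum and one summand are diagonal, so is the other summand. On powers of w the
  convolution is therefore a Cauchy product in one variable.\<close>

lemma sum_splits_diag:
  assumes "\<And>\<beta> \<gamma>. \<beta> \<notin> range diag \<Longrightarrow> t \<beta> \<gamma> = 0"
  shows "(\<Sum>(\<beta>, \<gamma>) | \<beta> + \<gamma> = diag j. t \<beta> \<gamma>) = (\<Sum>m\<le>j. t (diag m) (diag (j - m)))"
proof -
  have inj: "inj_on (\<lambda>m. (diag m, diag (j - m))) {..j}"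
    by (auto simp: inj_on_def vec_eq_iff)
  have "(\<Sum>(\<beta>, \<gamma>) | \<beta> + \<gamma> = diag j. t \<beta> \<gamma>) =
      (\<Sum>(\<beta>, \<gamma>) \<in> (\<lambda>m. (diag m, diag (j - m))) ` {..j}. t \<beta> \<gamma>)"
  proof (rule sum.mono_neutral_right[OF finite_splits])
    show "\<forall>x\<in>{(\<beta>, \<gamma>). \<beta> + \<gamma> = diag j} - (\<lambda>m. (diag m, diag (j - m))) ` {..j}.
        (case x of (\<beta>, \<gamma>) \<Rightarrow> t \<beta> \<gamma>) = 0"
    proof
      fix x assume x: "x \<in> {(\<beta>, \<gamma>). \<beta> + \<gamma> = diag j} - (\<lambda>m. (diag m, diag (j - m))) ` {..j}"
      then obtain \<beta> \<gamma> where x': "x = (\<beta>, \<gamma>)" "\<beta> + \<gamma> = diag j" by auto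
      have "\<beta> \<notin> range diag"
      proof
        assume "\<beta> \<in> range diag"
        then obtain m where m: "\<beta> = diag m" by auto
        have *: "m + \<gamma> $ i = j" for i using x'(2) m by (metis diag_nth vector_add_component)
        have "\<gamma> $ i = j - m" for i using *[of i] by linarith
        then have "\<gamma> = diag (j - m)" by (simp add: vec_eq_iff)
        moreover have "m \<le> j" using *[of 1] by linarith
        ultimately have "\<gamma> = diag (j - m)" "m \<le> j" .
        with x x' m show False by auto
      qed
      then show "(case x of (\<beta>, \<gamma>) \<Rightarrow> t \<beta> \<gamma>) = 0" using assms x' by simp
    qed
  qed (auto simp: vec_eq_iff)
  also have "\<dots> = (\<Sum>m\<le>j. t (diag m) (diag (j - m)))"
    by (subst sum.reindex[OF inj]) simp
  finally show ?thesis .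
qed

abbreviation (input) lam :: "complex \<Rightarrow> complex ^ 3" where
  "lam \<zeta> \<equiv> vector [1, \<zeta>, \<zeta>\<^sup>2]"

definition divisor :: "complex \<Rightarrow> 3 \<Rightarrow> nat ^ 3 \<Rightarrow> complex" where
  "divisor \<zeta> k \<alpha> = (\<Sum>i\<in>UNIV. of_nat (\<alpha> $ i) * lam \<zeta> $ i) - lam \<zeta> $ k"

section \<open>Eisenstein integers and the size of the divisors\<close>

context
  fixes \<zeta> :: complex
  assumes zeta: "\<zeta> ^ 3 = 1" "\<zeta> \<noteq> 1"
begin

lemma zeta_square: "\<zeta>\<^sup>2 = - 1 - \<zeta>"
proof -
  have "(\<zeta> - 1) * (\<zeta>\<^sup>2 + \<zeta> + 1) = 0" using zeta(1) by (simp add: algebra_simps power2_eq_square power3_eq_cube)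
  then have "\<zeta>\<^sup>2 + \<zeta> + 1 = 0" using zeta(2) by simp
  then show ?thesis by (simp add: algebra_simps eq_neg_iff_add_eq_0)
qed

text \<open>The norm form of the ring generated by \<zeta>. Since x^2 + x + 1 has no real root,
  \<zeta> has real part -1/2, and the squared imaginary part is 3/4 for either choice of
  \<zeta>.\<close>

lemma norm_Eisenstein: "(norm (of_int p + of_int q * \<zeta>))\<^sup>2 = of_int (p * p - p * q + q * q)"
proof -
  define x y where "x = Re \<zeta>" and "y = Im \<zeta>"
  have re: "x * x - y * y = - 1 - x" and im: "2 * (x * y) = - y"
    using arg_cong[OF zeta_square, of Re] arg_cong[OF zeta_square, of Im]
    by (auto simp: power2_eq_square x_def y_def mult.commute)
  have "y \<noteq> 0"
  proof
    assume "y = 0"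
    then have "(2 * x + 1)\<^sup>2 + 3 = 0" using re by (simp add: power2_eq_square algebra_simps)
    moreover have "(2 * x + 1)\<^sup>2 \<ge> 0" by simp
    ultimately show False by linarith
  qed
  then have x: "x = - 1 / 2" using im by (metis (no_types) mult_cancel_right mult.assoc mult_minus1 nonzero_mult_div_cancel_left zero_neq_numeral)
  then have y: "y * y = 3 / 4" using re by simp
  have "(norm (of_int p + of_int q * \<zeta>))\<^sup>2 = (of_int p + of_int q * x)\<^sup>2 + (of_int q * y)\<^sup>2"
    by (simp add: cmod_power2 x_def y_def)
  also have "\<dots> = of_int p * of_int p + 2 * of_int p * of_int q * x + of_int q * of_int q * (x * x + y * y)"
    by (simp add: power2_eq_square algebra_simps)
  also have "\<dots> = of_int (p * p - p * q + q * q)" using y by (simp add: x)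
  finally show ?thesis .
qed

lemma norm_Eisenstein_ge:
  assumes "of_int p + of_int q * \<zeta> \<noteq> 0"
  shows "1 \<le> norm (of_int p + of_int q * \<zeta>)" "\<bar>of_int p\<bar> + \<bar>of_int q\<bar> \<le> 2 * norm (of_int p + of_int q * \<zeta>)"
proof -
  let ?n = "norm (of_int p + of_int q * \<zeta>)"
  have "0 < ?n\<^sup>2" using assms by simp
  then have "1 \<le> p * p - p * q + q * q" unfolding norm_Eisenstein by linarith
  then have "1\<^sup>2 \<le> ?n\<^sup>2" unfolding norm_Eisenstein by (simp del: of_int_diff of_int_add of_int_mult)
  then show "1 \<le> ?n" by (rule power2_le_imp_le) simp
  \<comment> \<open>The factor 4 is attained at p = q. The claim reduces to 2 |pq| \<le> p^2 + q^2,
    used three times.\<close>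
  have "(\<bar>p\<bar> + \<bar>q\<bar>)\<^sup>2 \<le> 4 * (p * p - p * q + q * q)"
  proof -
    have "4 * (p * p - p * q + q * q) - (\<bar>p\<bar> + \<bar>q\<bar>)\<^sup>2 = 3 * (p * p + q * q) - 4 * (p * q) - 2 * \<bar>p * q\<bar>"
      by (simp add: power2_eq_square algebra_simps abs_mult)
    moreover have "0 \<le> (p - q) * (p - q)" "0 \<le> (p + q) * (p + q)" by simp_all
    then have "2 * \<bar>p * q\<bar> \<le> p * p + q * q" by (simp add: algebra_simps abs_le_iff)
    moreover have "p * q \<le> \<bar>p * q\<bar>" by simp
    ultimately show ?thesis by (smt (verit))
  qed
  then have "of_int ((\<bar>p\<bar> + \<bar>q\<bar>)\<^sup>2) \<le> (of_int (4 * (p * p - p * q + q * q)) :: real)"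
    by (simp only: of_int_le_iff)
  also have "\<dots> = (2 * ?n)\<^sup>2" by (simp add: power_mult_distrib norm_Eisenstein)
  finally have "(\<bar>of_int p\<bar> + \<bar>of_int q\<bar>)\<^sup>2 \<le> (2 * ?n)\<^sup>2" by simp
  then show "\<bar>of_int p\<bar> + \<bar>of_int q\<bar> \<le> 2 * ?n" by (rule power2_le_imp_le) simp
qed

lemma divisor_add_diag: "divisor \<zeta> k (\<alpha> + diag m) = divisor \<zeta> k \<alpha>"
  by (simp add: divisor_def sum_3 zeta_square algebra_simps)

lemma divisor_axis: "divisor \<zeta> k (axis k 1) = 0"
  using exhaust_3[of k] by (auto simp: divisor_def sum_3 axis_def)

text \<open>There are no small divisors, and a nonzero divisor even dominates the differences of the
  exponents, which compensates for the loss of a derivative in the homological equation.\<close>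

lemma divisor_bounds:
  assumes "divisor \<zeta> k \<alpha> \<noteq> 0"
  shows "1 \<le> norm (divisor \<zeta> k \<alpha>)"
    "\<bar>real (\<alpha> $ 1) - real (\<alpha> $ 3)\<bar> + \<bar>real (\<alpha> $ 2) - real (\<alpha> $ 3)\<bar> \<le> 4 * norm (divisor \<zeta> k \<alpha>)"
proof -
  define u v where "u = int (\<alpha> $ 1) - int (\<alpha> $ 3)" and "v = int (\<alpha> $ 2) - int (\<alpha> $ 3)"
  \<comment> \<open>Coordinates of the divisor in the basis 1, \<zeta>. As -\<zeta>^2 = 1 + \<zeta>,
    subtracting the third eigenvalue raises both coordinates by one.\<close>
  define p where "p = (if k = 1 then u - 1 else if k = 2 then u else u + 1)"
  define q where "q = (if k = 1 then v else if k = 2 then v - 1 else v + 1)"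
  have eq: "divisor \<zeta> k \<alpha> = of_int p + of_int q * \<zeta>"
    using exhaust_3[of k]
    by (auto simp: divisor_def sum_3 zeta_square p_def q_def u_def v_def algebra_simps)
  from norm_Eisenstein_ge[OF assms[unfolded eq]]
  have 1: "1 \<le> norm (divisor \<zeta> k \<alpha>)" and "\<bar>of_int p\<bar> + \<bar>of_int q\<bar> \<le> 2 * norm (divisor \<zeta> k \<alpha>)"
    by (simp_all add: eq)
  \<comment> \<open>Passing from (u, v) to (p, q) costs at most 2, which is at most twice the norm
    of the divisor because that norm is at least 1. This turns the factor 2 into 4.\<close>
  moreover have "\<bar>u\<bar> + \<bar>v\<bar> \<le> \<bar>p\<bar> + \<bar>q\<bar> + 2" by (auto simp: p_def q_def)
  then have "of_int (\<bar>u\<bar> + \<bar>v\<bar>) \<le> (of_int (\<bar>p\<bar> + \<bar>q\<bar> + 2) :: real)" by (simp only: of_int_le_iff)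
  ultimately show "\<bar>real (\<alpha> $ 1) - real (\<alpha> $ 3)\<bar> + \<bar>real (\<alpha> $ 2) - real (\<alpha> $ 3)\<bar> \<le> 4 * norm (divisor \<zeta> k \<alpha>)"
    by (simp add: u_def v_def)
  show "1 \<le> norm (divisor \<zeta> k \<alpha>)" by (rule 1)
qed

end

section \<open>Formal and convergent integrability\<close>

context
  fixes \<zeta> :: complex and Y1 Y2 Y3 :: "complex fps" and E F R N h :: "(complex, 3) mfps ^ 3"
  assumes zeta: "\<zeta> ^ 3 = 1" "\<zeta> \<noteq> 1"
    and Y: "fps_nth Y1 0 = 0" "fps_nth Y2 0 = 0" "fps_nth Y3 0 = 0"
    and E_def: "E = (\<chi> k. fps_subst (vector [Y1, Y2, Y3] $ k) (mfps_X 1 * mfps_X 2 * mfps_X 3))"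
    and N_def: "N = (\<chi> k. mfps_const (lam \<zeta> $ k) * mfps_X k + mfps_X k * E $ k)"
    and F_def: "F = (\<chi> k. mfps_const (lam \<zeta> $ k) * mfps_X k + R $ k)"
    and h: "distinguished_transformation (lam \<zeta>) F h N"
begin

section \<open>Coefficients of the normal form and its derivation\<close>

lemma starts_at_h: "starts_at 2 (h $ k)"
  using h by (simp add: distinguished_transformation_def normalizing_transformation_def)

lemma starts_at_z: "starts_at 1 ((\<chi> i. mfps_X i + h $ i) $ k)"
  by (simp only: vec_lambda_beta starts_at_X_add starts_at_h)

lemma transforms: "transforms_to F h N"
  using h by (simp add: distinguished_transformation_def normalizing_transformation_def)

lemma h_eq_0: "divisor \<zeta> k \<alpha> = 0 \<Longrightarrow> mfps_nth (h $ k) \<alpha> = 0"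
  using h unfolding distinguished_transformation_def nonresonant_def divisor_def by blast

lemma E_nth: "mfps_nth (E $ k) \<alpha> =
    (if \<alpha> = diag (\<alpha> $ 1) then fps_nth (vector [Y1, Y2, Y3] $ k) (\<alpha> $ 1) else 0)"
  by (simp add: E_def fps_subst_X123_nth)

lemma E_nondiag: "\<alpha> \<notin> range diag \<Longrightarrow> mfps_nth (E $ k) \<alpha> = 0"
  unfolding E_nth by (metis rangeI)

lemma E_diag: "mfps_nth (E $ k) (diag m) = fps_nth (vector [Y1, Y2, Y3] $ k) m"
  by (simp add: E_nth)

lemma starts_at_E: "starts_at 1 (E $ k)"
proof -
  have "diag 0 = 0" by (simp add: vec_eq_iff)
  then have "mfps_nth (E $ k) 0 = 0" using exhaust_3[of k] Y E_diag[of k 0] by auto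
  then show ?thesis by (simp add: starts_at_def)
qed

lemma N_nth_derivation:
  "mfps_nth (\<Sum>j\<in>UNIV. N $ j * mfps_deriv j f) \<alpha> =
    (\<Sum>j\<in>UNIV. of_nat (\<alpha> $ j) * lam \<zeta> $ j) * mfps_nth f \<alpha> +
    (\<Sum>(\<beta>, \<gamma>) | \<beta> + \<gamma> = \<alpha>. (\<Sum>j\<in>UNIV. mfps_nth (E $ j) \<beta> * of_nat (\<gamma> $ j)) * mfps_nth f \<gamma>)"
  unfolding N_def vec_lambda_beta by (rule normal_form_derivation_nth)

lemma lam_diag: "(\<Sum>j\<in>UNIV. of_nat (diag m $ j) * lam \<zeta> $ j) = 0"
  by (simp add: sum_3 zeta_square[OF zeta] algebra_simps)

lemma first_integral_imp_sum_Y_0: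
  assumes "first_integral F \<Phi>" and \<Phi>: "starts_at 4 (\<Phi> - mfps_X 1 * mfps_X 2 * mfps_X 3)"
  shows "Y1 + Y2 + Y3 = 0"
proof -
  let ?z = "\<chi> i. mfps_X i + h $ i"
  define \<Psi> where "\<Psi> = mfps_compose \<Phi> ?z"
  have "(\<Sum>j\<in>UNIV. N $ j * mfps_deriv j \<Psi>) = 0"
    unfolding \<Psi>_def transforms_to_derivation[OF transforms starts_at_h]
    using assms(1) by (simp add: first_integral_def)
  \<comment> \<open>On the diagonal the linear part contributes nothing and all exponents are equal,
    so only the sum of the three series remains.\<close>
  then have rec: "(\<Sum>m\<le>j. fps_nth (Y1 + Y2 + Y3) m * of_nat (j - m) * mfps_nth \<Psi> (diag (j - m))) = 0" for j
    using N_nth_derivation[of \<Psi> "diag j"] sum_splits_diag[of "\<lambda>\<beta> \<gamma>.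
        (\<Sum>i\<in>UNIV. mfps_nth (E $ i) \<beta> * of_nat (\<gamma> $ i)) * mfps_nth \<Psi> \<gamma>" j]
    unfolding lam_diag by (simp add: E_nondiag E_diag sum_3 distrib_right)
  \<comment> \<open>The substitution is tangent to the identity and \<open>\<Phi>\<close> has order
    three, so cubic coefficients are unchanged.\<close>
  have \<Psi>1: "mfps_nth \<Psi> (diag 1) = 1"
  proof -
    have "mfps_X 1 * mfps_X 2 * mfps_X 3 = (mfps_monom (diag 1) :: (complex, 3) mfps)" by (rule mfps_X123)
    moreover have "mdeg (diag 1) = 3" by (simp add: mdeg_def)
    ultimately have \<Phi>1: "mfps_nth \<Phi> (diag 1) = 1"
      using \<Phi> by (simp add: starts_at_def mfps_nth_monom)
    have "starts_at 3 (mfps_monom (diag 1) :: (complex, 3) mfps)"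
      by (auto simp: starts_at_def mfps_nth_monom mdeg_def)
    then have "starts_at 3 ((\<Phi> - mfps_X 1 * mfps_X 2 * mfps_X 3) + mfps_X 1 * mfps_X 2 * mfps_X 3)"
      unfolding mfps_X123 by (intro starts_at_add starts_at_mono[OF \<Phi>[unfolded mfps_X123]]) simp_all
    then have "starts_at 3 \<Phi>" by simp
    then have "starts_at (1 + 3) (mfps_compose \<Phi> ?z - mfps_compose \<Phi> (\<chi> i. mfps_X i))"
      by (intro starts_at_compose_diff starts_at_z) (simp_all add: starts_at_h flip: numeral_2_eq_2)
    then show ?thesis using \<Phi>1 \<open>mdeg (diag 1) = 3\<close>
      by (simp add: \<Psi>_def mfps_compose_ident starts_at_def)
  qed
  have "fps_nth (Y1 + Y2 + Y3) n = 0" for n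
  proof (induction n rule: less_induct)
    case (less n)
    \<comment> \<open>At the power n + 1 of w, indices below n vanish by induction, m = n has weight
      1 because the coefficient of w is 1, and m = n + 1 has weight 0.\<close>
    have "(\<Sum>m\<le>Suc n. fps_nth (Y1 + Y2 + Y3) m * of_nat (Suc n - m) * mfps_nth \<Psi> (diag (Suc n - m))) =
        (\<Sum>m\<le>Suc n. if m = n then fps_nth (Y1 + Y2 + Y3) n else 0)"
    proof (rule sum.cong)
      fix m assume "m \<in> {..Suc n}"
      then consider "m < n" | "m = n" | "m = Suc n" by force
      then show "fps_nth (Y1 + Y2 + Y3) m * of_nat (Suc n - m) * mfps_nth \<Psi> (diag (Suc n - m)) =
          (if m = n then fps_nth (Y1 + Y2 + Y3) n else 0)"
      proof cases
        case 1
        then show ?thesis using less[of m] by (simp del: fps_add_nth)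
      qed (use \<Psi>1 in \<open>simp_all del: fps_add_nth\<close>)
    qed simp
    then show ?case using rec[of "Suc n"] by (simp del: fps_add_nth)
  qed
  then show ?thesis by (simp add: fps_eq_iff)
qed

text \<open>The conjugacy relation with the identity part removed: the derivation maps the k-th
  coordinate to \<open>N $ k\<close>, and moving the linear term of \<open>F\<close> applied to
  \<open>h\<close> to the left produces the divisor.\<close>

lemma homological_equation:
  "divisor \<zeta> k \<alpha> * mfps_nth (h $ k) \<alpha> +
    (\<Sum>(\<beta>, \<gamma>) | \<beta> + \<gamma> = \<alpha>. (\<Sum>j\<in>UNIV. mfps_nth (E $ j) \<beta> * of_nat (\<gamma> $ j)) * mfps_nth (h $ k) \<gamma>) =
   mfps_nth (mfps_compose (R $ k) (\<chi> i. mfps_X i + h $ i)) \<alpha> - mfps_nth (mfps_X k * E $ k) \<alpha>"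
proof -
  have "(\<Sum>j\<in>UNIV. N $ j * mfps_deriv j (mfps_X k)) = (\<Sum>j\<in>UNIV. if j = k then N $ k else 0)"
    by (rule sum.cong) (auto simp: mfps_deriv_X)
  then have DX: "(\<Sum>j\<in>UNIV. N $ j * mfps_deriv j (mfps_X k)) = N $ k" by simp
  have "(\<Sum>j\<in>UNIV. N $ j * mfps_deriv j (h $ k)) =
      (\<Sum>j\<in>UNIV. mfps_deriv j (mfps_X k + h $ k) * N $ j) - (\<Sum>j\<in>UNIV. N $ j * mfps_deriv j (mfps_X k))"
    by (simp add: mfps_deriv_add distrib_left sum.distrib mult.commute)
  also have "\<dots> = mfps_compose (F $ k) (\<chi> i. mfps_X i + h $ i) - N $ k"
    using transforms by (simp add: DX transforms_to_def)
  also have "\<dots> = mfps_const (lam \<zeta> $ k) * h $ k + mfps_compose (R $ k) (\<chi> i. mfps_X i + h $ i) - mfps_X k * E $ k"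
    by (simp add: F_def N_def mfps_compose_add mfps_compose_const_mult mfps_compose_X[OF starts_at_z] distrib_left)
  finally have "mfps_nth (\<Sum>j\<in>UNIV. N $ j * mfps_deriv j (h $ k)) \<alpha> = lam \<zeta> $ k * mfps_nth (h $ k) \<alpha>
      + mfps_nth (mfps_compose (R $ k) (\<chi> i. mfps_X i + h $ i)) \<alpha> - mfps_nth (mfps_X k * E $ k) \<alpha>"
    by simp
  then show ?thesis unfolding N_nth_derivation divisor_def left_diff_distrib by algebra
qed

text \<open>Since \<open>h\<close> has no resonant terms and \<open>E\<close> is supported on the diagonal, which does not change the
  divisor, each \<open>\<alpha>\<close> contributes either to \<open>h\<close> or to the normal form.\<close>

lemma majorant_inequality:
  assumes sum_Y: "Y1 + Y2 + Y3 = 0"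
  shows "max (norm (mfps_nth (h $ k) \<alpha>)) (norm (mfps_nth (mfps_X k * E $ k) \<alpha>)) \<le>
      norm (mfps_nth (mfps_compose (R $ k) (\<chi> i. mfps_X i + h $ i)) \<alpha>) +
      4 * (\<Sum>(\<beta>, \<gamma>) | \<beta> + \<gamma> = \<alpha>. (\<Sum>j\<in>UNIV. norm (mfps_nth (E $ j) \<beta>)) * norm (mfps_nth (h $ k) \<gamma>))"
    (is "_ \<le> norm ?r + 4 * ?S")
proof -
  let ?s = "\<Sum>(\<beta>, \<gamma>) | \<beta> + \<gamma> = \<alpha>. (\<Sum>j\<in>UNIV. mfps_nth (E $ j) \<beta> * of_nat (\<gamma> $ j)) * mfps_nth (h $ k) \<gamma>"
  have S: "0 \<le> ?S" by (intro sum_nonneg) (auto intro!: mult_nonneg_nonneg sum_nonneg)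
  show ?thesis
  proof (cases "divisor \<zeta> k \<alpha> = 0")
    case True
    \<comment> \<open>A diagonal \<beta> leaves the divisor of \<gamma> equal to that of \<alpha>,
      namely zero, and \<open>h\<close> vanishes at such \<gamma>.\<close>
    have "?s = 0"
    proof (intro sum.neutral ballI)
      fix x assume "x \<in> {(\<beta>, \<gamma>). \<beta> + \<gamma> = \<alpha>}"
      then obtain \<beta> \<gamma> where x: "x = (\<beta>, \<gamma>)" "\<alpha> = \<gamma> + \<beta>" by (auto simp: add.commute)
      show "(case x of (\<beta>, \<gamma>) \<Rightarrow> (\<Sum>j\<in>UNIV. mfps_nth (E $ j) \<beta> * of_nat (\<gamma> $ j)) * mfps_nth (h $ k) \<gamma>) = 0"
      proof (cases "\<beta> \<in> range diag")
        case True
        then have "divisor \<zeta> k \<gamma> = 0" using \<open>divisor \<zeta> k \<alpha> = 0\<close> x(2) divisor_add_diag[OF zeta] by auto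
        then show ?thesis by (simp add: x h_eq_0)
      qed (simp add: x E_nondiag)
    qed
    then have "?r = mfps_nth (mfps_X k * E $ k) \<alpha>"
      using homological_equation[of k \<alpha>] True by simp
    then show ?thesis using h_eq_0[OF True] S by simp
  next
    case False
    let ?d = "norm (divisor \<zeta> k \<alpha>)"
    \<comment> \<open>The exponents in this component are a unit vector plus a diagonal one and have
      divisor zero, contrary to the present case.\<close>
    have XE: "mfps_nth (mfps_X k * E $ k) \<alpha> = 0"
    proof (cases "\<exists>\<beta>. \<alpha> = axis k (Suc 0) + \<beta>")
      case True
      then obtain \<beta> where \<beta>: "\<alpha> = axis k (Suc 0) + \<beta>" by blast
      then have "\<beta> \<notin> range diag"
        using False divisor_add_diag[OF zeta, of k "axis k 1"] divisor_axis[OF zeta, of k] by auto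
      then show ?thesis
        unfolding \<beta> mfps_monom_axis[symmetric] mfps_nth_monom_mult by (rule E_nondiag)
    next
      case False
      then show ?thesis by (auto simp: mfps_nth_monom_mult_0 simp flip: mfps_monom_axis)
    qed
    have "norm ?s \<le> (\<Sum>(\<beta>, \<gamma>) | \<beta> + \<gamma> = \<alpha>. 4 * ?d * ((\<Sum>j\<in>UNIV. norm (mfps_nth (E $ j) \<beta>)) * norm (mfps_nth (h $ k) \<gamma>)))"
    proof (rule sum_norm_le)
      fix x assume "x \<in> {(\<beta>, \<gamma>). \<beta> + \<gamma> = \<alpha>}"
      then obtain \<beta> \<gamma> where x: "x = (\<beta>, \<gamma>)" "\<alpha> = \<beta> + \<gamma>" by auto
      have "norm (\<Sum>j\<in>UNIV. mfps_nth (E $ j) \<beta> * of_nat (\<gamma> $ j)) \<le> 4 * ?d * (\<Sum>j\<in>UNIV. norm (mfps_nth (E $ j) \<beta>))"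
      proof (cases "\<beta> \<in> range diag")
        case True
        then obtain m where m: "\<beta> = diag m" by auto
        define u v where "u = real (\<gamma> $ 1) - real (\<gamma> $ 3)" and "v = real (\<gamma> $ 2) - real (\<gamma> $ 3)"
        have "fps_nth (Y1 + Y2 + Y3) m = 0" using sum_Y by simp
        \<comment> \<open>Eliminating the third component turns the exponent weights into the
          differences u and v.\<close>
        then have E3: "mfps_nth (E $ 3) \<beta> = - mfps_nth (E $ 1) \<beta> - mfps_nth (E $ 2) \<beta>"
          by (simp add: m E_diag add_eq_0_iff)
        have "(\<Sum>j\<in>UNIV. mfps_nth (E $ j) \<beta> * of_nat (\<gamma> $ j)) =
            of_real u * mfps_nth (E $ 1) \<beta> + of_real v * mfps_nth (E $ 2) \<beta>"
          unfolding sum_3 E3 by (simp add: u_def v_def algebra_simps)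
        also have "norm \<dots> \<le> \<bar>u\<bar> * norm (mfps_nth (E $ 1) \<beta>) + \<bar>v\<bar> * norm (mfps_nth (E $ 2) \<beta>)"
          by (rule order_trans[OF norm_triangle_ineq]) (simp add: norm_mult)
        also have "\<dots> \<le> \<bar>u\<bar> * (\<Sum>j\<in>UNIV. norm (mfps_nth (E $ j) \<beta>)) + \<bar>v\<bar> * (\<Sum>j\<in>UNIV. norm (mfps_nth (E $ j) \<beta>))"
          unfolding sum_3 by (intro add_mono mult_left_mono) auto
        \<comment> \<open>The differences for \<gamma> and for \<alpha> agree because \<beta> is
          diagonal, so the divisor at \<alpha> bounds them. Dividing by it later absorbs the
          derivative.\<close>
        also have "\<dots> \<le> 4 * ?d * (\<Sum>j\<in>UNIV. norm (mfps_nth (E $ j) \<beta>))"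
          unfolding distrib_right[symmetric] using divisor_bounds(2)[OF zeta False]
          by (intro mult_right_mono sum_nonneg) (auto simp: u_def v_def x m)
        finally show ?thesis .
      qed (simp add: E_nondiag)
      then have "norm (\<Sum>j\<in>UNIV. mfps_nth (E $ j) \<beta> * of_nat (\<gamma> $ j)) * norm (mfps_nth (h $ k) \<gamma>) \<le>
          4 * ?d * (\<Sum>j\<in>UNIV. norm (mfps_nth (E $ j) \<beta>)) * norm (mfps_nth (h $ k) \<gamma>)"
        by (rule mult_right_mono) simp
      then show "norm (case x of (\<beta>, \<gamma>) \<Rightarrow> (\<Sum>j\<in>UNIV. mfps_nth (E $ j) \<beta> * of_nat (\<gamma> $ j)) * mfps_nth (h $ k) \<gamma>)
          \<le> (case x of (\<beta>, \<gamma>) \<Rightarrow> 4 * ?d * ((\<Sum>j\<in>UNIV. norm (mfps_nth (E $ j) \<beta>)) * norm (mfps_nth (h $ k) \<gamma>)))"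
        by (simp add: x norm_mult mult.assoc)
    qed
    also have "\<dots> = ?d * (4 * ?S)" unfolding case_prod_unfold sum_distrib_left[symmetric] by simp
    finally have s: "norm ?s \<le> ?d * (4 * ?S)" .
    have "divisor \<zeta> k \<alpha> * mfps_nth (h $ k) \<alpha> = ?r - ?s"
      using homological_equation[of k \<alpha>] XE by (simp add: algebra_simps)
    then have "?d * norm (mfps_nth (h $ k) \<alpha>) \<le> norm ?r + norm ?s"
      unfolding norm_mult[symmetric] by (simp only: norm_triangle_ineq4)
    also have "\<dots> \<le> ?d * norm ?r + ?d * (4 * ?S)"
      using s divisor_bounds(1)[OF zeta False] mult_right_mono[of 1 ?d "norm ?r"] by simp
    also have "\<dots> = ?d * (norm ?r + 4 * ?S)" by (simp add: distrib_left)
    finally have "norm (mfps_nth (h $ k) \<alpha>) \<le> norm ?r + 4 * ?S" using False by simp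
    then show ?thesis using XE S by simp
  qed
qed

section \<open>Convergence and the first integral when Y1 + Y2 + Y3 = 0\<close>

context
  assumes R: "\<And>k. starts_at 2 (R $ k)" "\<And>k. majorized (R $ k)" and sum_Y: "Y1 + Y2 + Y3 = 0"
begin

lemma majorized_h: "majorized (h $ k)"
  by (rule majorized_normalization(1)[OF starts_at_h starts_at_E R _ majorant_inequality[OF sum_Y]]) simp

lemma majorized_E: "majorized (E $ k)"
  by (rule majorized_normalization(2)[OF starts_at_h starts_at_E R _ majorant_inequality[OF sum_Y]]) simp

lemma convergent_N: "mfps_convergent (N $ k)"
  unfolding N_def vec_lambda_beta
  by (intro majorized_imp_convergent majorized_add majorized_mult majorized_const majorized_X majorized_E)

text \<open>The witness is w expressed in the original coordinates, i.e. the product of the three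
  components of the inverse transformation, each of which converges.\<close>

lemma convergent_first_integral:
  "\<exists>\<Phi>. first_integral F \<Phi> \<and> mfps_convergent \<Phi> \<and> starts_at 4 (\<Phi> - mfps_X 1 * mfps_X 2 * mfps_X 3)"
proof -
  let ?w = "mfps_X 1 * mfps_X 2 * mfps_X 3 :: (complex, 3) mfps"
  let ?z = "\<chi> i. mfps_X i + h $ i"
  obtain g where g: "\<And>k. starts_at 2 (g $ k)"
    and gh: "\<And>k. g $ k = - mfps_compose (h $ k) (\<chi> i. mfps_X i + g $ i)"
    using inverse_fixpoint[OF starts_at_h] by blast
  let ?G = "\<chi> i. mfps_X i + g $ i"
  have G: "\<And>k. starts_at 1 (?G $ k)" by (simp only: vec_lambda_beta starts_at_X_add g)
  define \<Phi> where "\<Phi> = mfps_compose ?w ?G"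
  have \<Phi>: "\<Phi> = (mfps_X 1 + g $ 1) * (mfps_X 2 + g $ 2) * (mfps_X 3 + g $ 3)"
    by (simp add: \<Phi>_def mfps_compose_mult[OF G] mfps_compose_X[OF G])
  have "majorized (g $ k)" for k
    by (rule majorized_inverse[OF starts_at_h majorized_h g gh])
  then have "mfps_convergent \<Phi>"
    unfolding \<Phi> by (intro majorized_imp_convergent majorized_mult majorized_add majorized_X)
  moreover have "starts_at 4 (\<Phi> - ?w)"
  proof -
    have "starts_at (1 + 3) (mfps_compose ?w ?G - mfps_compose ?w (\<chi> i. mfps_X i))"
    proof (rule starts_at_compose_diff)
      show "starts_at 3 ?w"
        unfolding mfps_X123 by (auto simp: starts_at_def mfps_nth_monom mdeg_def)
      show "starts_at 1 (?G $ i)" for i by (rule G)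
    qed (simp_all add: g flip: numeral_2_eq_2)
    then show ?thesis by (simp add: \<Phi>_def mfps_compose_ident)
  qed
  moreover have "first_integral F \<Phi>"
  proof -
    have "mfps_compose \<Phi> ?z = ?w"
      using inverse_fixpoint_left_inverse[OF starts_at_h g gh]
      by (simp add: \<Phi> mfps_compose_mult[OF starts_at_z])
    moreover have "(\<Sum>j\<in>UNIV. N $ j * mfps_deriv j ?w) = 0"
    proof (rule mfps_eqI)
      fix \<alpha>
      have "(\<Sum>j\<in>UNIV. of_nat (\<alpha> $ j) * lam \<zeta> $ j) * mfps_nth ?w \<alpha> = 0"
        unfolding mfps_X123 mfps_nth_monom using lam_diag[of 1] by auto
      moreover have "(\<Sum>(\<beta>, \<gamma>) | \<beta> + \<gamma> = \<alpha>.
          (\<Sum>j\<in>UNIV. mfps_nth (E $ j) \<beta> * of_nat (\<gamma> $ j)) * mfps_nth ?w \<gamma>) = 0"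
      proof (intro sum.neutral ballI)
        fix x
        \<comment> \<open>The exponents of w are all one, so the weighted sum of the components of
          \<open>E\<close> becomes their plain sum.\<close>
        have "(\<Sum>j\<in>UNIV. mfps_nth (E $ j) \<beta>) = 0" for \<beta>
        proof (cases "\<beta> \<in> range diag")
          case True
          then obtain m where "\<beta> = diag m" by auto
          moreover have "fps_nth (Y1 + Y2 + Y3) m = 0" using sum_Y by simp
          ultimately show ?thesis by (simp add: E_diag sum_3)
        qed (simp add: E_nondiag)
        then show "(case x of (\<beta>, \<gamma>) \<Rightarrow>
            (\<Sum>j\<in>UNIV. mfps_nth (E $ j) \<beta> * of_nat (\<gamma> $ j)) * mfps_nth ?w \<gamma>) = 0"
          unfolding mfps_X123 by (cases x) (simp add: mfps_nth_monom)
      qed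
      ultimately show "mfps_nth (\<Sum>j\<in>UNIV. N $ j * mfps_deriv j ?w) \<alpha> = mfps_nth 0 \<alpha>"
        unfolding N_nth_derivation by simp
    qed
    ultimately have "mfps_compose (\<Sum>k\<in>UNIV. F $ k * mfps_deriv k \<Phi>) ?z = 0"
      using transforms_to_derivation[OF transforms starts_at_h, of \<Phi>] by simp
    \<comment> \<open>Only the pullback of the derivative of \<open>\<Phi>\<close> along
      \<open>F\<close> is known to vanish; substituting the inverse removes the pullback.\<close>
    then have "mfps_compose (mfps_compose (\<Sum>k\<in>UNIV. F $ k * mfps_deriv k \<Phi>) ?z) ?G = 0" by simp
    moreover have "mfps_compose (mfps_compose f ?z) ?G = f" for f
      using inverse_fixpoint_right_inverse[OF starts_at_h g gh]
      by (simp add: mfps_compose_assoc[OF G starts_at_z] mfps_compose_ident)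
    ultimately show ?thesis by (simp add: first_integral_def)
  qed
  ultimately show ?thesis by blast
qed

end

end

section \<open>The polynomial system as an instance\<close>

theorem theorem4:
  fixes \<zeta> :: complex
    and S :: "(int \<times> nat \<times> nat) set"
    and a :: "int \<Rightarrow> nat \<Rightarrow> nat \<Rightarrow> complex"
    and b :: "nat \<Rightarrow> int \<Rightarrow> nat \<Rightarrow> complex"
    and c :: "nat \<Rightarrow> nat \<Rightarrow> int \<Rightarrow> complex"
    and Y1 Y2 Y3 :: "complex fps"
    and F N :: "(complex, 3) mfps ^ 3"
  assumes zeta: "\<zeta> ^ 3 = 1" "\<zeta> \<noteq> 1"
    and S: "finite S" "\<forall>(p, q, r) \<in> S. p \<ge> - 1 \<and> p + int q + int r \<ge> 1"
    and F: "F = vector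
      [mfps_X 1 + (\<Sum>(p, q, r)\<in>S. mfps_const (a p q r) *
                     mfps_X 1 ^ nat (p + 1) * mfps_X 2 ^ q * mfps_X 3 ^ r),
       mfps_const \<zeta> *
         (mfps_X 2 + (\<Sum>(p, q, r)\<in>S. mfps_const (b r p q) *
                     mfps_X 1 ^ r * mfps_X 2 ^ nat (p + 1) * mfps_X 3 ^ q)),
       mfps_const (\<zeta> ^ 2) *
         (mfps_X 3 + (\<Sum>(p, q, r)\<in>S. mfps_const (c q r p) *
                     mfps_X 1 ^ q * mfps_X 2 ^ r * mfps_X 3 ^ nat (p + 1)))]"
    and Y: "fps_nth Y1 0 = 0" "fps_nth Y2 0 = 0" "fps_nth Y3 0 = 0"
    and N: "N = vector
      [mfps_X 1 + mfps_X 1 * fps_subst Y1 (mfps_X 1 * mfps_X 2 * mfps_X 3),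
       mfps_const \<zeta> * mfps_X 2 + mfps_X 2 * fps_subst Y2 (mfps_X 1 * mfps_X 2 * mfps_X 3),
       mfps_const (\<zeta> ^ 2) * mfps_X 3 + mfps_X 3 * fps_subst Y3 (mfps_X 1 * mfps_X 2 * mfps_X 3)]"
    and dnf: "distinguished_normal_form (vector [1, \<zeta>, \<zeta> ^ 2]) F N"
  shows "((\<exists>\<Phi>. first_integral F \<Phi> \<and> starts_at 4 (\<Phi> - mfps_X 1 * mfps_X 2 * mfps_X 3)) \<longrightarrow>
            Y1 + Y2 + Y3 = 0 \<and> (\<forall>k. mfps_convergent (N $ k))) \<and>
         (Y1 + Y2 + Y3 = 0 \<longrightarrow>
            (\<exists>\<Phi>. first_integral F \<Phi> \<and> mfps_convergent \<Phi> \<and>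
                  starts_at 4 (\<Phi> - mfps_X 1 * mfps_X 2 * mfps_X 3)))"
proof -
  define R :: "(complex, 3) mfps ^ 3" where "R = vector
      [\<Sum>(p, q, r)\<in>S. mfps_const (a p q r) * mfps_X 1 ^ nat (p + 1) * mfps_X 2 ^ q * mfps_X 3 ^ r,
       mfps_const \<zeta> * (\<Sum>(p, q, r)\<in>S. mfps_const (b r p q) *
         mfps_X 1 ^ r * mfps_X 2 ^ nat (p + 1) * mfps_X 3 ^ q),
       mfps_const (\<zeta> ^ 2) * (\<Sum>(p, q, r)\<in>S. mfps_const (c q r p) *
         mfps_X 1 ^ q * mfps_X 2 ^ r * mfps_X 3 ^ nat (p + 1))]"
  define E :: "(complex, 3) mfps ^ 3" where
    "E = (\<chi> k. fps_subst (vector [Y1, Y2, Y3] $ k) (mfps_X 1 * mfps_X 2 * mfps_X 3))"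
  have F': "F = (\<chi> k. mfps_const (lam \<zeta> $ k) * mfps_X k + R $ k)"
    by (simp add: F R_def vec_eq_iff forall_3 mfps_const_1 distrib_left)
  have N': "N = (\<chi> k. mfps_const (lam \<zeta> $ k) * mfps_X k + mfps_X k * E $ k)"
    by (simp add: N E_def vec_eq_iff forall_3 mfps_const_1)
  obtain h where h: "distinguished_transformation (lam \<zeta>) F h N"
    using dnf by (auto simp: distinguished_normal_form_def)
  have monomial: "starts_at 2 (mfps_const d * mfps_X 1 ^ i * mfps_X 2 ^ j * mfps_X 3 ^ k :: (complex, 3) mfps)"
    if "2 \<le> i + j + k" for d i j k
  proof -
    have "starts_at (0 + i + j + k) (mfps_const d * mfps_X 1 ^ i * mfps_X 2 ^ j * mfps_X 3 ^ k :: (complex, 3) mfps)"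
      by (intro starts_at_mult starts_at_power) simp_all
    then show ?thesis by (rule starts_at_mono) (use that in simp)
  qed
  \<comment> \<open>As p \<ge> -1, the conversion \<open>nat (p + 1)\<close> loses nothing, and the
    total degree is p + q + r + 1.\<close>
  have deg: "2 \<le> nat (p + 1) + q + r" if "(p, q, r) \<in> S" for p q r
    using S(2) that by fastforce
  have R2: "starts_at 2 (R $ k)" for k
  proof -
    have "starts_at 2 (R $ 1)" "starts_at 2 (R $ 2)" "starts_at 2 (R $ 3)"
      by (auto simp: R_def intro!: starts_at_sum starts_at_mult_right monomial dest!: deg)
    then show ?thesis using exhaust_3[of k] by auto
  qed
  have "majorized (R $ k)" for k
  proof -
    have "majorized (R $ 1)" "majorized (R $ 2)" "majorized (R $ 3)"
      by (auto simp: R_def intro!: majorized_sum majorized_mult majorized_power majorized_const majorized_X)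
    then show ?thesis using exhaust_3[of k] by auto
  qed
  note convergent = convergent_N[OF zeta Y E_def N' F' h R2 this]
    convergent_first_integral[OF zeta Y E_def N' F' h R2 this]
  show ?thesis
    using convergent first_integral_imp_sum_Y_0[OF zeta Y E_def N' F' h] by blast
qed

end
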